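(* Let $k$ be an algebraically closed field of characteristic zero, and let $D$ be a locally nilpotent $k$-derivation of $B=k[x,y,z]$ that is nice (i.e. $D^2(x)=D^2(y)=D^2(z)=0$) and admits a slice $s$ (i.e. $D(s)=1$). Let $N\in\mathbb{Z}\setminus\{0\}$. Then $D$ is automorphically conjugate to $\frac{\partial}{\partial z}$, i.e. there is $\phi\in\operatorname{Aut}_k(B)$ with $\phi D\phi^{-1}=\frac{\partial}{\partial z}$, and the $\mathbb{G}_{\mathrm m}$-action on $\mathbb{A}^3=\operatorname{Spec}(B)$ associated with $\partial=NsD$ is linearizable.
   Context: A $k$-derivation $D$ of $B$ is locally nilpotent if for every $b\in B$ there is $m\ge1$ with $D^m(b)=0$. With $A=\ker D$, $B=A[s]$ is a polynomial ring in $s$ over $A$, and the action associated with $\partial=NsD$ is $\alpha_t(P(s))=P(t^Ns)$ for $P\in A[T]$, $t\in k^*$. It is called linearizable if there exists $\phi\in\operatorname{Aut}_k(B)$ such that $\phi\partial\phi^{-1}$ is a diagonal linear derivation $\lambda_1x\frac{\partial}{\partial x}+\lambda_2y\frac{\partial}{\partial y}+\lambda_3z\frac{\partial}{\partial z}$, $\lambda_i\in k$. *)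

theory Defs
  imports "HOL-Computational_Algebra.Computational_Algebra"
begin

text \<open>
  The ring \<open>B = k[x,y,z]\<close> is represented as \<open>k[x][y][z]\<close>: the outermost polynomial variable
  is \<open>z\<close>, the innermost one is \<open>x\<close>.
\<close>

type_synonym 'k poly3 = "'k poly poly poly"

definition scalar3 :: "'k::zero \<Rightarrow> 'k poly3" where
  "scalar3 c = [:[:[:c:]:]:]"

definition var_x :: "'k::field poly3" where
  "var_x = [:[:[:0, 1:]:]:]"

definition var_y :: "'k::field poly3" where
  "var_y = [:[:0, 1:]:]"

definition var_z :: "'k::field poly3" where
  "var_z = [:0, 1:]"

definition partial_x :: "'k::field poly3 \<Rightarrow> 'k poly3" where
  "partial_x = map_poly (map_poly pderiv)"

definition partial_y :: "'k::field poly3 \<Rightarrow> 'k poly3" where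
  "partial_y = map_poly pderiv"

definition partial_z :: "'k::field poly3 \<Rightarrow> 'k poly3" where
  "partial_z = pderiv"

definition k_derivation :: "('k::field poly3 \<Rightarrow> 'k poly3) \<Rightarrow> bool" where
  "k_derivation D \<longleftrightarrow>
     (\<forall>f g. D (f + g) = D f + D g) \<and>
     (\<forall>c f. D (scalar3 c * f) = scalar3 c * D f) \<and>
     (\<forall>f g. D (f * g) = D f * g + f * D g)"

definition locally_nilpotent :: "('k::field poly3 \<Rightarrow> 'k poly3) \<Rightarrow> bool" where
  "locally_nilpotent D \<longleftrightarrow> (\<forall>b. \<exists>m\<ge>1. (D ^^ m) b = 0)"

definition nice_derivation :: "('k::field poly3 \<Rightarrow> 'k poly3) \<Rightarrow> bool" where
  "nice_derivation D \<longleftrightarrow>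
     D (D var_x) = 0 \<and> D (D var_y) = 0 \<and> D (D var_z) = 0"

definition slice :: "('k::field poly3 \<Rightarrow> 'k poly3) \<Rightarrow> 'k poly3 \<Rightarrow> bool" where
  "slice D s \<longleftrightarrow> D s = 1"

definition k_automorphism :: "('k::field poly3 \<Rightarrow> 'k poly3) \<Rightarrow> bool" where
  "k_automorphism \<phi> \<longleftrightarrow> bij \<phi> \<and>
     (\<forall>f g. \<phi> (f + g) = \<phi> f + \<phi> g) \<and>
     (\<forall>f g. \<phi> (f * g) = \<phi> f * \<phi> g) \<and>
     (\<forall>c. \<phi> (scalar3 c) = scalar3 c)"

definition diagonal_derivation :: "'k::field \<Rightarrow> 'k \<Rightarrow> 'k \<Rightarrow> 'k poly3 \<Rightarrow> 'k poly3" where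
  "diagonal_derivation l1 l2 l3 =
     (\<lambda>f. scalar3 l1 * var_x * partial_x f
        + scalar3 l2 * var_y * partial_y f
        + scalar3 l3 * var_z * partial_z f)"

text \<open>
  A \<open>G_m\<close>-action on \<open>Spec B\<close>, given by the induced maps \<open>\<alpha> t\<close> on \<open>B\<close> for \<open>t \<noteq> 0\<close>; the value
  \<open>\<alpha> 0\<close> is irrelevant. The last conjunct (regularity of the action) says that \<open>t \<mapsto> \<alpha> t b\<close>
  is a Laurent polynomial in \<open>t\<close> with coefficients in \<open>B\<close>; as \<open>k\<close> is infinite in the intended
  use, this amounts to a coaction \<open>B \<rightarrow> B[t, 1/t]\<close>.
\<close>

definition gm_action :: "('k::field \<Rightarrow> 'k poly3 \<Rightarrow> 'k poly3) \<Rightarrow> bool" where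
  "gm_action \<alpha> \<longleftrightarrow>
     (\<forall>t. t \<noteq> 0 \<longrightarrow> k_automorphism (\<alpha> t)) \<and>
     \<alpha> 1 = id \<and>
     (\<forall>t u. t \<noteq> 0 \<longrightarrow> u \<noteq> 0 \<longrightarrow> \<alpha> (t * u) = \<alpha> t \<circ> \<alpha> u) \<and>
     (\<forall>b. \<exists>I c. finite I \<and>
        (\<forall>t. t \<noteq> 0 \<longrightarrow> \<alpha> t b = (\<Sum>i\<in>I. scalar3 (t powi i) * c i)))"

text \<open>
  \<open>\<alpha>\<close> is the \<open>G_m\<close>-action associated with \<open>\<delta>\<close> if \<open>\<delta> b\<close> is the derivative of the Laurent
  polynomial \<open>t \<mapsto> \<alpha> t b\<close> at \<open>t = 1\<close>.
\<close>

definition gm_action_associated ::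
  "('k::field poly3 \<Rightarrow> 'k poly3) \<Rightarrow> ('k \<Rightarrow> 'k poly3 \<Rightarrow> 'k poly3) \<Rightarrow> bool" where
  "gm_action_associated \<delta> \<alpha> \<longleftrightarrow> gm_action \<alpha> \<and>
     (\<forall>b. \<exists>I c. finite I \<and>
        (\<forall>t. t \<noteq> 0 \<longrightarrow> \<alpha> t b = (\<Sum>i\<in>I. scalar3 (t powi i) * c i)) \<and>
        \<delta> b = (\<Sum>i\<in>I. of_int i * c i))"

definition gm_linearizable :: "('k::field \<Rightarrow> 'k poly3 \<Rightarrow> 'k poly3) \<Rightarrow> bool" where
  "gm_linearizable \<alpha> \<longleftrightarrow>
     (\<exists>\<delta>. gm_action_associated \<delta> \<alpha> \<and>
       (\<exists>\<phi> l1 l2 l3. k_automorphism \<phi> \<and>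
          \<phi> \<circ> \<delta> \<circ> inv \<phi> = diagonal_derivation l1 l2 l3))"

text \<open>
  The map \<open>P(s) \<mapsto> P(t^N s)\<close> for \<open>P\<close> with coefficients in \<open>ker D\<close>; it is well defined on all
  of \<open>B\<close> because \<open>B = (ker D)[s]\<close> is a polynomial ring in the slice \<open>s\<close> when \<open>D\<close> is locally
  nilpotent.
\<close>

definition slice_action ::
  "('k::field poly3 \<Rightarrow> 'k poly3) \<Rightarrow> 'k poly3 \<Rightarrow> int \<Rightarrow> 'k \<Rightarrow> 'k poly3 \<Rightarrow> 'k poly3" where
  "slice_action D s N t b =
     (let P = (THE P. (\<forall>i. D (coeff P i) = 0) \<and> poly P s = b)
      in poly P (scalar3 (t powi N) * s))"

end

theory Submission
  imports "Berlekamp_Zassenhaus.Unique_Factorization_Poly" Defs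
begin

text \<open>
  Write \<open>H = (Dx, Dy, Dz)\<close>. As \<open>D\<close> is nice, the entries of \<open>H\<close> lie in the kernel, the flow of
  \<open>D\<close> moves a point \<open>p\<close> along the straight line \<open>p + T H(p)\<close>, and the slice gives
  \<open>H \<cdot> grad s = 1\<close>, so that \<open>H\<close> vanishes nowhere. Affine space is thus filled by disjoint
  lines, and everything rests on the claim that the entries of \<open>H\<close> are linearly dependent
  over \<open>k\<close>: all the lines are parallel to one plane (lemma \<open>components_linearly_dependent\<close>).

  To see this, take a nonconstant \<open>f\<close> in the kernel. It is constant along the lines, so its
  leading form \<open>F\<close> satisfies \<open>F(H) = 0\<close>: the directions lie on a projective plane curve
  (\<open>leading_form_relation\<close>). Cut this curve with a line \<open>\<lambda> = 0\<close>. Modulo a prime factor \<open>w\<close> of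
  \<open>\<lambda>(H)\<close> the form \<open>F\<close> becomes a binary form, which splits into linear factors; hence \<open>H\<close> is
  congruent modulo \<open>w\<close> to a multiple of a constant vector \<open>d\<close>. As \<open>H\<close> is unimodular, this forces
  \<open>w\<close> to divide its own derivative in the direction \<open>d\<close>, so this derivative is zero: \<open>w = 0\<close> is
  a cylinder with direction \<open>d\<close>. Two such cylinders with different directions are disjoint,
  because \<open>H\<close> vanishes nowhere. But three pairwise disjoint cylinders cannot have linearly
  independent directions (\<open>no_three_disjoint_cylinders\<close>), so all directions \<open>d\<close> that occur
  are orthogonal to one vector \<open>\<mu>\<close>, and then every such \<open>w\<close> divides \<open>\<mu>(H)\<close>. If \<open>\<mu>(H)\<close> is not
  zero, it has finitely many prime factors, each of which divides \<open>\<lambda>(H)\<close> for at most two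
  members of a family of \<open>\<lambda>\<close> in general position. So \<open>\<lambda>(H)\<close> is a constant for two of them, and
  the entries of \<open>H\<close> are dependent after all.

  After a linear change of coordinates \<open>Dx = 0\<close>. Write \<open>b = Dy\<close> and \<open>c = Dz\<close>. Now
  \<open>b b\<^sub>y + c b\<^sub>z = 0\<close>, \<open>b c\<^sub>y + c c\<^sub>z = 0\<close> and the unimodularity of \<open>(b, c)\<close> give divisibilities
  such as \<open>c dvd c\<^sub>y\<close>, which force \<open>b\<close> and \<open>c\<close> into \<open>k[x]\<close>. A Bezout relation between them gives a
  matrix of determinant one over \<open>k[x]\<close> that turns \<open>D\<close> into \<open>\<partial>/\<partial>z\<close>; a translation
  of \<open>z\<close> then turns \<open>s\<close> into \<open>z\<close>. In these coordinates the kernel is \<open>k[x,y]\<close>, the action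
  multiplies \<open>z\<close> by \<open>t\<^sup>N\<close>, and its infinitesimal generator \<open>N z \<partial>/\<partial>z\<close> is diagonal.
\<close>

(* inv stands for the inverse of a function, not for the inverse in a group. *)
unbundle no m_inv_syntax

section \<open>Homomorphisms and derivations on three variables\<close>

lemma poly3_induct [case_names scalar x y z add mult]:
  fixes f :: "'k::field poly3"
  assumes sc: "\<And>c. P (scalar3 c)" and x: "P var_x" and y: "P var_y" and z: "P var_z"
    and add: "\<And>f g. P f \<Longrightarrow> P g \<Longrightarrow> P (f + g)"
    and mult: "\<And>f g. P f \<Longrightarrow> P g \<Longrightarrow> P (f * g)"
  shows "P f"
proof -
  have one: "P [:[:p:]:]" for p :: "'k poly"
  proof (induction p)
    case 0
    show ?case using sc[of 0] by (simp add: scalar3_def)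
  next
    case (pCons a p)
    have "[:[:pCons a p:]:] = scalar3 a + var_x * [:[:p:]:]"
      by (simp add: scalar3_def var_x_def)
    then show ?case using add[OF sc mult[OF x pCons.IH]] by metis
  qed
  have two: "P [:p:]" for p :: "'k poly poly"
  proof (induction p)
    case 0
    show ?case using sc[of 0] by (simp add: scalar3_def)
  next
    case (pCons a p)
    have "[:pCons a p:] = [:[:a:]:] + var_y * [:p:]" by (simp add: var_y_def)
    then show ?case using add[OF one mult[OF y pCons.IH]] by metis
  qed
  show ?thesis
  proof (induction f)
    case 0
    show ?case using sc[of 0] by (simp add: scalar3_def)
  next
    case (pCons a p)
    have "pCons a p = [:a:] + var_z * p" by (simp add: var_z_def)
    then show ?case using add[OF two mult[OF z pCons.IH]] by metis
  qed
qed

lemma scalar3_hom: "comm_ring_hom (scalar3 :: 'k::field \<Rightarrow> 'k poly3)"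
  by unfold_locales (simp_all add: scalar3_def)

interpretation scalar3: inj_comm_ring_hom "scalar3 :: 'k::field \<Rightarrow> 'k poly3"
  by unfold_locales (simp_all add: scalar3_def)

lemma comm_ring_hom_comp: "comm_ring_hom g \<Longrightarrow> comm_ring_hom h \<Longrightarrow> comm_ring_hom (\<lambda>f. g (h f))"
proof -
  assume g: "comm_ring_hom g" and h: "comm_ring_hom h"
  interpret g: comm_ring_hom g by (fact g)
  interpret h: comm_ring_hom h by (fact h)
  show ?thesis by unfold_locales (simp_all add: g.hom_add h.hom_add g.hom_mult h.hom_mult)
qed

lemma const_hom: "comm_ring_hom (\<lambda>c :: 'r::comm_ring_1. [:c:])"
  by unfold_locales simp_all

lemma id_hom: "comm_ring_hom (\<lambda>c :: 'r::comm_ring_1. c)"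
  by unfold_locales simp_all

lemma poly_hom: "comm_ring_hom (\<lambda>p. poly p (t :: 'r::comm_ring_1))"
  by unfold_locales simp_all

text \<open>
  Evaluation at a point, restriction to a line, the flow and changes of coordinates are all
  instances, with different targets.
\<close>
definition subst3 :: "('k \<Rightarrow> 'r) \<Rightarrow> 'r \<Rightarrow> 'r \<Rightarrow> 'r \<Rightarrow> 'k::field poly3 \<Rightarrow> 'r::comm_ring_1" where
  "subst3 \<iota> p q r = (\<lambda>f. eval_poly (\<lambda>g. eval_poly (\<lambda>h. eval_poly \<iota> h p) g q) f r)"

lemma eval_poly_hom:
  assumes "comm_ring_hom h"
  shows "comm_ring_hom (\<lambda>p. eval_poly h p r)"
proof -
  interpret comm_ring_hom h by fact
  interpret m: map_poly_comm_ring_hom h ..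
  show ?thesis
    by unfold_locales (simp_all add: eval_poly_def m.hom_mult m.hom_add)
qed

lemma subst3_hom: "comm_ring_hom \<iota> \<Longrightarrow> comm_ring_hom (subst3 \<iota> p q r)"
  unfolding subst3_def by (intro eval_poly_hom)

lemma eval_poly_const: "comm_ring_hom h \<Longrightarrow> eval_poly h [:u:] v = h u"
proof -
  assume "comm_ring_hom h"
  then interpret comm_ring_hom h .
  show ?thesis by (simp add: eval_poly_def hom_distribs)
qed

lemma eval_poly_var: "comm_ring_hom h \<Longrightarrow> eval_poly h [:0, 1:] v = v"
proof -
  assume "comm_ring_hom h"
  then interpret comm_ring_hom h .
  show ?thesis by (simp add: eval_poly_def hom_distribs)
qed

lemma subst3_simps:
  fixes \<iota> :: "'k::field \<Rightarrow> 'r::comm_ring_1"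
  assumes "comm_ring_hom \<iota>"
  shows "subst3 \<iota> p q r (scalar3 c) = \<iota> c" "subst3 \<iota> p q r var_x = p"
    "subst3 \<iota> p q r var_y = q" "subst3 \<iota> p q r var_z = r"
proof -
  note h1 = eval_poly_hom[OF assms, of p]
  note h2 = eval_poly_hom[OF h1, of q]
  note s = eval_poly_const[OF h2] eval_poly_const[OF h1] eval_poly_const[OF assms]
    eval_poly_var[OF h2] eval_poly_var[OF h1] eval_poly_var[OF assms]
  show "subst3 \<iota> p q r (scalar3 c) = \<iota> c" "subst3 \<iota> p q r var_x = p"
    "subst3 \<iota> p q r var_y = q" "subst3 \<iota> p q r var_z = r"
    unfolding subst3_def scalar3_def var_x_def var_y_def var_z_def s by (rule refl)+
qed

lemma poly3_hom_eq:
  fixes g h :: "'k::field poly3 \<Rightarrow> 'r::comm_ring_1"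
  assumes "comm_ring_hom g" "comm_ring_hom h" "\<And>c. g (scalar3 c) = h (scalar3 c)"
    "g var_x = h var_x" "g var_y = h var_y" "g var_z = h var_z"
  shows "g = h"
proof
  interpret g: comm_ring_hom g by fact
  interpret h: comm_ring_hom h by fact
  show "g f = h f" for f
    by (induction f rule: poly3_induct) (simp_all add: assms g.hom_add h.hom_add g.hom_mult h.hom_mult)
qed

definition derivation_along :: "('k::field poly3 \<Rightarrow> 'r) \<Rightarrow> ('k poly3 \<Rightarrow> 'r::comm_ring_1) \<Rightarrow> bool" where
  "derivation_along h E \<longleftrightarrow> (\<forall>f g. E (f + g) = E f + E g) \<and>
     (\<forall>f g. E (f * g) = E f * h g + h f * E g) \<and> (\<forall>c. E (scalar3 c) = 0)"

lemma derivation_along_eq: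
  assumes "derivation_along h E" "derivation_along h F"
    "E var_x = F var_x" "E var_y = F var_y" "E var_z = F var_z"
  shows "E f = F f"
  using assms unfolding derivation_along_def
  by (induction f rule: poly3_induct) simp_all

lemma map_poly_mult_derivation:
  fixes d :: "'r::comm_ring_1 \<Rightarrow> 'r"
  assumes add: "\<And>f g. d (f + g) = d f + d g" and mult: "\<And>f g. d (f * g) = d f * g + f * d g"
  shows "map_poly d (p + q) = map_poly d p + map_poly d q"
    and "map_poly d (p * q) = map_poly d p * q + p * map_poly d q"
proof -
  have 0: "d 0 = 0" using add[of 0 0] by simp
  have s: "d (sum F A) = (\<Sum>i\<in>A. d (F i))" for F and A :: "nat set"
    by (induction A rule: infinite_finite_induct) (simp_all add: 0 add)
  show "map_poly d (p + q) = map_poly d p + map_poly d q"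
    by (rule poly_eqI) (simp add: coeff_map_poly 0 add)
  show "map_poly d (p * q) = map_poly d p * q + p * map_poly d q"
    by (rule poly_eqI) (simp add: coeff_map_poly 0 coeff_mult s mult sum.distrib)
qed

lemma map_poly_const: "d 0 = 0 \<Longrightarrow> map_poly d [:u:] = [:d u:]"
  by (rule poly_eqI) (simp add: coeff_map_poly coeff_pCons split: nat.split)

lemma derivation_partial:
  "derivation_along id partial_x" "derivation_along id partial_y" "derivation_along id partial_z"
proof -
  note d1 = map_poly_mult_derivation[of pderiv]
  note d2 = map_poly_mult_derivation[of "map_poly pderiv"]
  have m: "pderiv (p * q) = pderiv p * q + p * pderiv q" for p q :: "'r::idom poly"
    by (simp add: pderiv_mult algebra_simps)
  show "derivation_along id partial_x" "derivation_along id partial_y" "derivation_along id partial_z"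
    by (simp_all add: derivation_along_def partial_x_def partial_y_def partial_z_def scalar3_def
      pderiv_add m d1 d2 map_poly_const)
qed

lemmas partial_simps = derivation_partial[unfolded derivation_along_def id_def, THEN conjunct1, rule_format]
  derivation_partial[unfolded derivation_along_def id_def, THEN conjunct2, THEN conjunct1, rule_format]
  derivation_partial[unfolded derivation_along_def id_def, THEN conjunct2, THEN conjunct2, rule_format]

lemma partial_var [simp]:
  "partial_x var_x = 1" "partial_x var_y = 0" "partial_x var_z = 0"
  "partial_y var_x = 0" "partial_y var_y = 1" "partial_y var_z = 0"
  "partial_z var_x = 0" "partial_z var_y = 0" "partial_z var_z = 1"
proof -
  have v: "map_poly d [:0, 1:] = 0" if "d 0 = 0" "d 1 = 0" for d :: "'r::comm_ring_1 \<Rightarrow> 'r"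
    by (rule poly_eqI) (simp add: that coeff_map_poly coeff_pCons split: nat.split)
  have p1: "map_poly d 1 = 0" if "d 0 = 0" "d 1 = 0" for d :: "'r::comm_ring_1 \<Rightarrow> 'r"
    unfolding one_pCons using map_poly_const[of d 1] that by simp
  show "partial_x var_x = 1" "partial_x var_y = 0" "partial_x var_z = 0"
    "partial_y var_x = 0" "partial_y var_y = 1" "partial_y var_z = 0"
    "partial_z var_x = 0" "partial_z var_y = 0" "partial_z var_z = 1"
    by (simp_all add: partial_x_def partial_y_def partial_z_def var_x_def var_y_def var_z_def
      map_poly_const pderiv_pCons v p1)
qed

lemma k_derivation_along:
  assumes "k_derivation D"
  shows "derivation_along id D"
proof -
  have l: "D (f * g) = D f * g + f * D g" and s: "D (scalar3 c * f) = scalar3 c * D f" for f g c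
    using assms by (auto simp: k_derivation_def)
  have "D 1 = D 1 + D 1" using l[of 1 1] by (simp only: mult_1 mult_1_right)
  then have "D 1 = 0" by (metis add_cancel_right_right)
  then have "D (scalar3 c) = 0" for c using s[of c 1] by simp
  then show ?thesis using assms by (simp add: derivation_along_def k_derivation_def)
qed

lemma derivation_along_combination:
  assumes "comm_ring_hom h"
  shows "derivation_along h (\<lambda>f. a * h (partial_x f) + b * h (partial_y f) + c * h (partial_z f))"
proof -
  interpret comm_ring_hom h by fact
  show ?thesis unfolding derivation_along_def
    by (simp add: partial_simps hom_add hom_mult algebra_simps)
qed

text \<open>
  The chain rule. For \<open>h\<close> the identity it says that a derivation is determined by its values
  on the variables; for \<open>h\<close> the restriction to a line it computes derivatives along that line.
\<close>
lemma derivation_along_gradient: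
  assumes "comm_ring_hom h" "derivation_along h E"
  shows "E f = E var_x * h (partial_x f) + E var_y * h (partial_y f) + E var_z * h (partial_z f)"
proof -
  interpret comm_ring_hom h by fact
  show ?thesis by (rule derivation_along_eq[OF assms(2) derivation_along_combination[OF assms(1)]]) simp_all
qed

section \<open>Evaluation at points and along lines\<close>

definition eval3 :: "'k::field \<Rightarrow> 'k \<Rightarrow> 'k \<Rightarrow> 'k poly3 \<Rightarrow> 'k" where
  "eval3 = subst3 (\<lambda>c. c)"

lemma eval3_hom: "comm_ring_hom (eval3 p q r)"
  unfolding eval3_def by (intro subst3_hom id_hom)

interpretation eval3: comm_ring_hom "eval3 p q r"
  by (rule eval3_hom)

lemma eval3_simps [simp]:
  "eval3 p q r (scalar3 c) = c" "eval3 p q r var_x = p" "eval3 p q r var_y = q" "eval3 p q r var_z = r"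
  unfolding eval3_def by (simp_all add: subst3_simps id_hom)

lemma eval3_nested: "eval3 p q r f = poly (poly (poly f [:[:r:]:]) [:q:]) p"
proof -
  have v: "poly (poly (poly (scalar3 c) [:[:r:]:]) [:q:]) p = c" "poly (poly (poly var_x [:[:r:]:]) [:q:]) p = p"
    "poly (poly (poly var_y [:[:r:]:]) [:q:]) p = q" "poly (poly (poly var_z [:[:r:]:]) [:q:]) p = r" for c
    by (simp_all add: scalar3_def var_x_def var_y_def var_z_def)
  have "eval3 p q r = (\<lambda>f. poly (poly (poly f [:[:r:]:]) [:q:]) p)"
    by (rule poly3_hom_eq[OF eval3_hom])
      (intro comm_ring_hom_comp[OF poly_hom comm_ring_hom_comp[OF poly_hom poly_hom]],
       simp_all only: eval3_simps v)
  then show ?thesis by (rule fun_cong)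
qed

lemma exists_nonroot:
  fixes p :: "'r::idom poly" and h :: "'k::field_char_0 \<Rightarrow> 'r"
  assumes "p \<noteq> 0" "inj h"
  shows "\<exists>c. poly p (h c) \<noteq> 0"
proof (rule ccontr)
  assume "\<not> ?thesis"
  then have "range h \<subseteq> {x. poly p x = 0}" by auto
  then have "finite (range h)" using poly_roots_finite[OF assms(1)] finite_subset by blast
  then show False using finite_imageD[OF _ assms(2)] infinite_UNIV_char_0 by blast
qed

lemma eval3_nonzero:
  fixes f :: "'k::field_char_0 poly3"
  assumes "f \<noteq> 0"
  shows "\<exists>p q r. eval3 p q r f \<noteq> 0"
proof -
  obtain r where r: "poly f [:[:r:]:] \<noteq> 0"
    using exists_nonroot[OF assms, of "\<lambda>c. [:[:c:]:]"] by (auto simp: inj_def)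
  obtain q where q: "poly (poly f [:[:r:]:]) [:q:] \<noteq> 0"
    using exists_nonroot[OF r, of "\<lambda>c. [:c:]"] by (auto simp: inj_def)
  obtain p where "poly (poly (poly f [:[:r:]:]) [:q:]) p \<noteq> 0"
    using exists_nonroot[OF q, of "\<lambda>c. c"] by (auto simp: inj_def)
  then show ?thesis by (metis eval3_nested)
qed

definition dirder :: "'k::field \<Rightarrow> 'k \<Rightarrow> 'k \<Rightarrow> 'k poly3 \<Rightarrow> 'k poly3" where
  "dirder d1 d2 d3 f = scalar3 d1 * partial_x f + scalar3 d2 * partial_y f + scalar3 d3 * partial_z f"

lemma dirder_axes [simp]: "dirder 1 0 0 = partial_x" "dirder 0 1 0 = partial_y" "dirder 0 0 1 = partial_z"
  by (simp_all add: dirder_def fun_eq_iff)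

definition line3 :: "'k::field \<Rightarrow> 'k \<Rightarrow> 'k \<Rightarrow> 'k \<Rightarrow> 'k \<Rightarrow> 'k \<Rightarrow> 'k poly3 \<Rightarrow> 'k poly" where
  "line3 q1 q2 q3 d1 d2 d3 = subst3 (\<lambda>c. [:c:]) [:q1, d1:] [:q2, d2:] [:q3, d3:]"

lemma line3_hom: "comm_ring_hom (line3 q1 q2 q3 d1 d2 d3)"
  unfolding line3_def by (intro subst3_hom const_hom)

lemma line3_simps [simp]:
  "line3 q1 q2 q3 d1 d2 d3 (scalar3 c) = [:c:]" "line3 q1 q2 q3 d1 d2 d3 var_x = [:q1, d1:]"
  "line3 q1 q2 q3 d1 d2 d3 var_y = [:q2, d2:]" "line3 q1 q2 q3 d1 d2 d3 var_z = [:q3, d3:]"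
  unfolding line3_def by (simp_all add: subst3_simps const_hom)

lemma poly_line3:
  "poly (line3 q1 q2 q3 d1 d2 d3 f) t = eval3 (q1 + t * d1) (q2 + t * d2) (q3 + t * d3) f"
proof -
  have "(\<lambda>f. poly (line3 q1 q2 q3 d1 d2 d3 f) t) = eval3 (q1 + t * d1) (q2 + t * d2) (q3 + t * d3)"
    by (rule poly3_hom_eq[OF comm_ring_hom_comp[OF poly_hom line3_hom] eval3_hom]) simp_all
  then show ?thesis by (rule fun_cong)
qed

lemma pderiv_along:
  fixes h :: "'k::field poly3 \<Rightarrow> 'r::idom poly"
  assumes "comm_ring_hom h" "\<And>c. pderiv (h (scalar3 c)) = 0"
  shows "derivation_along h (\<lambda>f. pderiv (h f))"
proof -
  interpret comm_ring_hom h by fact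
  show ?thesis by (simp add: derivation_along_def hom_add hom_mult pderiv_add pderiv_mult assms algebra_simps)
qed

lemma pderiv_line3:
  "pderiv (line3 q1 q2 q3 d1 d2 d3 f) = line3 q1 q2 q3 d1 d2 d3 (dirder d1 d2 d3 f)"
proof -
  interpret comm_ring_hom "line3 q1 q2 q3 d1 d2 d3" by (rule line3_hom)
  have d: "derivation_along (line3 q1 q2 q3 d1 d2 d3) (\<lambda>f. pderiv (line3 q1 q2 q3 d1 d2 d3 f))"
    by (rule pderiv_along[OF line3_hom]) simp
  show ?thesis
    by (subst derivation_along_gradient[OF line3_hom d])
      (simp add: dirder_def hom_add hom_mult pderiv_pCons)
qed

text \<open>
  Restricted to any line in the given direction, \<open>w\<close> becomes a univariate polynomial that divides
  its own derivative; by degrees this derivative vanishes. As the line is arbitrary, so does the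
  directional derivative itself.
\<close>
lemma dvd_dirder_imp_zero:
  fixes w :: "'k::field_char_0 poly3"
  assumes "w dvd dirder d1 d2 d3 w"
  shows "dirder d1 d2 d3 w = 0"
proof (rule ccontr)
  assume "\<not> ?thesis"
  then obtain p q r where nz: "eval3 p q r (dirder d1 d2 d3 w) \<noteq> 0" using eval3_nonzero by blast
  interpret comm_ring_hom "line3 p q r d1 d2 d3" by (rule line3_hom)
  let ?W = "line3 p q r d1 d2 d3 w"
  have "?W dvd pderiv ?W" unfolding pderiv_line3 using assms by (elim dvdE) (simp add: hom_mult)
  then have "degree ?W = 0" using not_dvd_pderiv by blast
  then have "pderiv ?W = 0" by (simp add: pderiv_eq_0_iff)
  then have "poly (line3 p q r d1 d2 d3 (dirder d1 d2 d3 w)) 0 = 0" by (simp add: pderiv_line3)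
  then show False using nz by (simp add: poly_line3)
qed

lemma nonconstant_poly_root:
  fixes p :: "'k::alg_closed_field poly"
  assumes "coeff p 1 \<noteq> 0"
  shows "\<exists>t. poly p t = 0"
proof -
  have "degree p > 0" using assms le_degree by fastforce
  then show ?thesis using alg_closed_imp_poly_has_root by blast
qed

text \<open>
  Near a point where the derivative of \<open>u\<close> along \<open>e\<close> does not vanish, let the line with direction
  \<open>e\<close> move along a second direction \<open>d\<close>. The linear coefficient of the restriction of \<open>u\<close> to this
  line is a nonzero polynomial in the parameter \<open>r\<close>, so all but finitely many of these lines meet
  the surface \<open>u = 0\<close>.
\<close>
lemma dirder_nonzero_imp_zeros:
  fixes u :: "'k::{alg_closed_field, field_char_0} poly3"
  assumes "dirder e1 e2 e3 u \<noteq> 0"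
  shows "\<exists>q1 q2 q3. \<forall>d1 d2 d3.
    finite {r. \<forall>t. eval3 (q1 + r * d1 + t * e1) (q2 + r * d2 + t * e2) (q3 + r * d3 + t * e3) u \<noteq> 0}"
proof -
  obtain q1 q2 q3 where nz: "eval3 q1 q2 q3 (dirder e1 e2 e3 u) \<noteq> 0"
    using eval3_nonzero[OF assms] by blast
  have "finite {r. \<forall>t. eval3 (q1 + r * d1 + t * e1) (q2 + r * d2 + t * e2) (q3 + r * d3 + t * e3) u \<noteq> 0}"
    for d1 d2 d3
  proof -
    define M where "M = subst3 (\<lambda>c. [:[:c:]:]) [:[:q1, d1:], [:e1:]:] [:[:q2, d2:], [:e2:]:] [:[:q3, d3:], [:e3:]:]"
    have c: "comm_ring_hom (\<lambda>c :: 'k. [:[:c:]:])" by (intro comm_ring_hom_comp[OF const_hom const_hom])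
    have M: "comm_ring_hom M" unfolding M_def by (intro subst3_hom c)
    have Ms: "M (scalar3 c) = [:[:c:]:]" "M var_x = [:[:q1, d1:], [:e1:]:]" "M var_y = [:[:q2, d2:], [:e2:]:]"
      "M var_z = [:[:q3, d3:], [:e3:]:]" for c
      unfolding M_def by (simp_all add: subst3_simps c)
    have line: "map_poly (\<lambda>g. poly g r) (M u) = line3 (q1 + r * d1) (q2 + r * d2) (q3 + r * d3) e1 e2 e3 u" for r
    proof -
      have mp: "map_poly (\<lambda>g. poly g r) [:a, b:] = [:poly a r, poly b r:]" for a b :: "'k poly"
        by (rule poly_eqI) (simp add: coeff_map_poly coeff_pCons split: nat.split)
      interpret ph: comm_ring_hom "\<lambda>g. poly g r" by (rule poly_hom)
      interpret mph: map_poly_comm_ring_hom "\<lambda>g. poly g r" ..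
      have "(\<lambda>u. map_poly (\<lambda>g. poly g r) (M u)) = line3 (q1 + r * d1) (q2 + r * d2) (q3 + r * d3) e1 e2 e3"
        by (rule poly3_hom_eq[OF comm_ring_hom_comp[OF mph.comm_ring_hom_axioms M] line3_hom])
          (simp_all add: Ms mp map_poly_const)
      then show ?thesis by (rule fun_cong)
    qed
    let ?c = "coeff (M u) 1"
    have cr: "poly ?c r = coeff (line3 (q1 + r * d1) (q2 + r * d2) (q3 + r * d3) e1 e2 e3 u) 1" for r
      by (simp flip: line add: coeff_map_poly)
    have "poly ?c 0 = poly (pderiv (line3 q1 q2 q3 e1 e2 e3 u)) 0"
      unfolding cr by (simp add: poly_0_coeff_0 coeff_pderiv)
    also have "\<dots> \<noteq> 0" using nz by (simp add: pderiv_line3 poly_line3)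
    finally have "?c \<noteq> 0" by auto
    then have "finite {r. poly ?c r = 0}" by (rule poly_roots_finite)
    moreover have "{r. \<forall>t. eval3 (q1 + r * d1 + t * e1) (q2 + r * d2 + t * e2) (q3 + r * d3 + t * e3) u \<noteq> 0}
        \<subseteq> {r. poly ?c r = 0}"
      using nonconstant_poly_root unfolding cr poly_line3[symmetric] by blast
    ultimately show ?thesis by (rule rev_finite_subset)
  qed
  then show ?thesis by blast
qed

lemma dirder_zero_eval3:
  fixes u :: "'k::field_char_0 poly3"
  assumes "dirder d1 d2 d3 u = 0"
  shows "eval3 (q1 + t * d1) (q2 + t * d2) (q3 + t * d3) u = eval3 q1 q2 q3 u"
proof -
  interpret comm_ring_hom "line3 q1 q2 q3 d1 d2 d3" by (rule line3_hom)
  have "pderiv (line3 q1 q2 q3 d1 d2 d3 u) = 0" by (simp add: pderiv_line3 assms)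
  then obtain c where "line3 q1 q2 q3 d1 d2 d3 u = [:c:]" by (metis pderiv_eq_0_iff degree_eq_zeroE)
  then have "poly (line3 q1 q2 q3 d1 d2 d3 u) t = poly (line3 q1 q2 q3 d1 d2 d3 u) 0" by simp
  then show ?thesis by (simp add: poly_line3)
qed

lemma partials_zero_imp_scalar:
  fixes f :: "'k::field_char_0 poly3"
  assumes "partial_x f = 0" "partial_y f = 0" "partial_z f = 0"
  shows "\<exists>c. f = scalar3 c"
proof -
  have 0: "dirder d1 d2 d3 f = 0" for d1 d2 d3 by (simp add: dirder_def assms)
  have "eval3 p q r (f - scalar3 (eval3 0 0 0 f)) = 0" for p q r
    using dirder_zero_eval3[OF 0, of 0 1 p 0 q 0 r] by (simp add: eval3.hom_minus)
  then have "f - scalar3 (eval3 0 0 0 f) = 0" using eval3_nonzero by blast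
  then show ?thesis by (metis eq_iff_diff_eq_0)
qed

lemma nonconstant_has_zero:
  fixes w :: "'k::{alg_closed_field, field_char_0} poly3"
  assumes "\<And>c. w \<noteq> scalar3 c"
  shows "\<exists>p q r. eval3 p q r w = 0"
proof -
  obtain e1 e2 e3 where "dirder e1 e2 e3 w \<noteq> 0"
    using partials_zero_imp_scalar[of w] assms by (metis dirder_axes)
  then obtain q1 q2 q3 where "finite {r. \<forall>t. eval3 (q1 + r * 0 + t * e1) (q2 + r * 0 + t * e2) (q3 + r * 0 + t * e3) w \<noteq> 0}"
    using dirder_nonzero_imp_zeros by blast
  then have "{r :: 'k. \<forall>t. eval3 (q1 + r * 0 + t * e1) (q2 + r * 0 + t * e2) (q3 + r * 0 + t * e3) w \<noteq> 0} \<noteq> UNIV"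
    using infinite_UNIV_char_0 by metis
  then show ?thesis by blast
qed

section \<open>Disjoint cylinders in affine space\<close>

definition det3 :: "'k::field \<Rightarrow> 'k \<Rightarrow> 'k \<Rightarrow> 'k \<Rightarrow> 'k \<Rightarrow> 'k \<Rightarrow> 'k \<Rightarrow> 'k \<Rightarrow> 'k \<Rightarrow> 'k" where
  "det3 d1 d2 d3 e1 e2 e3 f1 f2 f3 =
     d1 * (e2 * f3 - e3 * f2) - d2 * (e1 * f3 - e3 * f1) + d3 * (e1 * f2 - e2 * f1)"

lemma cramer3:
  assumes "det3 d1 d2 d3 e1 e2 e3 f1 f2 f3 \<noteq> (0 :: 'k::field)"
  obtains a b c where "p = a * d1 + b * e1 + c * f1" "q = a * d2 + b * e2 + c * f2"
    "r = a * d3 + b * e3 + c * f3"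
proof -
  let ?d = "det3 d1 d2 d3 e1 e2 e3 f1 f2 f3"
  let ?a = "det3 p q r e1 e2 e3 f1 f2 f3" and ?b = "det3 d1 d2 d3 p q r f1 f2 f3"
    and ?c = "det3 d1 d2 d3 e1 e2 e3 p q r"
  have s: "x = ?a / ?d * x1 + ?b / ?d * x2 + ?c / ?d * x3" if "?d * x = ?a * x1 + ?b * x2 + ?c * x3"
    for x x1 x2 x3
    using assms that by (simp add: field_simps)
  show ?thesis
    by (rule that[of "?a / ?d" "?b / ?d" "?c / ?d"]; rule s) (simp_all add: det3_def algebra_simps)
qed

text \<open>
  In coordinates along \<open>d\<close>, \<open>e\<close>, \<open>f\<close> the cylinder \<open>u = 0\<close> is free in the first and has points over
  almost every value of the third coordinate; \<open>v = 0\<close> is free in the second, again with points over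
  almost every value of the third. So the free coordinates can be adjusted to produce a common point.
\<close>
lemma cylinders_meet_transversally:
  fixes u v :: "'k::{alg_closed_field, field_char_0} poly3"
  assumes det: "det3 d1 d2 d3 e1 e2 e3 f1 f2 f3 \<noteq> 0"
    and u: "dirder d1 d2 d3 u = 0" "dirder e1 e2 e3 u \<noteq> 0"
    and v: "dirder e1 e2 e3 v = 0" "dirder d1 d2 d3 v \<noteq> 0"
  shows "\<exists>p q r. eval3 p q r u = 0 \<and> eval3 p q r v = 0"
proof -
  obtain q1 q2 q3 where q: "finite {r. \<forall>t. eval3 (q1 + r * f1 + t * e1) (q2 + r * f2 + t * e2) (q3 + r * f3 + t * e3) u \<noteq> 0}"
    (is "finite ?Q") using dirder_nonzero_imp_zeros[OF u(2)] by blast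
  obtain p1 p2 p3 where p: "finite {r. \<forall>t. eval3 (p1 + r * f1 + t * d1) (p2 + r * f2 + t * d2) (p3 + r * f3 + t * d3) v \<noteq> 0}"
    (is "finite ?P") using dirder_nonzero_imp_zeros[OF v(2)] by blast
  obtain a b c where abc: "q1 = a * d1 + b * e1 + c * f1" "q2 = a * d2 + b * e2 + c * f2" "q3 = a * d3 + b * e3 + c * f3"
    using cramer3[OF det] by blast
  obtain a' b' c' where abc': "p1 = a' * d1 + b' * e1 + c' * f1" "p2 = a' * d2 + b' * e2 + c' * f2" "p3 = a' * d3 + b' * e3 + c' * f3"
    using cramer3[OF det] by blast
  \<comment> \<open>The lines start at points with third coordinates \<open>c\<close> and \<open>c'\<close>; the shift makes their final third coordinates agree.\<close>
  have "finite (?Q \<union> (\<lambda>r. r + c' - c) ` ?P)" using q p by blast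
  then obtain r where r: "r \<notin> ?Q \<union> (\<lambda>r. r + c' - c) ` ?P" using infinite_UNIV_char_0 ex_new_if_finite by blast
  then have "r \<notin> ?Q" by blast
  then obtain t where t: "eval3 (q1 + r * f1 + t * e1) (q2 + r * f2 + t * e2) (q3 + r * f3 + t * e3) u = 0" by blast
  have "r = (r + c - c') + c' - c" by simp
  then have "r + c - c' \<notin> ?P" using r by blast
  then obtain t' where t': "eval3 (p1 + (r + c - c') * f1 + t' * d1) (p2 + (r + c - c') * f2 + t' * d2)
      (p3 + (r + c - c') * f3 + t' * d3) v = 0" by blast
  let ?a = "a' + t'" and ?b = "b + t" and ?c = "c + r"
  have "eval3 (?a * d1 + ?b * e1 + ?c * f1) (?a * d2 + ?b * e2 + ?c * f2) (?a * d3 + ?b * e3 + ?c * f3) u = 0"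
    using t dirder_zero_eval3[OF u(1), of "q1 + r * f1 + t * e1" "?a - a" "q2 + r * f2 + t * e2" "q3 + r * f3 + t * e3"]
    by (simp add: abc algebra_simps)
  moreover have "eval3 (?a * d1 + ?b * e1 + ?c * f1) (?a * d2 + ?b * e2 + ?c * f2) (?a * d3 + ?b * e3 + ?c * f3) v = 0"
    using t' dirder_zero_eval3[OF v(1), of "p1 + (r + c - c') * f1 + t' * d1" "?b - b'"
        "p2 + (r + c - c') * f2 + t' * d2" "p3 + (r + c - c') * f3 + t' * d3"]
    by (simp add: abc' algebra_simps)
  ultimately show ?thesis by blast
qed

text \<open>
  Here \<open>u\<close> depends only on the \<open>e\<close>-coordinate and \<open>v\<close> only on the \<open>f\<close>-coordinate.
\<close>
lemma cylinders_meet_parallel: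
  fixes u v :: "'k::{alg_closed_field, field_char_0} poly3"
  assumes det: "det3 d1 d2 d3 e1 e2 e3 f1 f2 f3 \<noteq> 0"
    and u: "dirder d1 d2 d3 u = 0" "dirder f1 f2 f3 u = 0" "\<exists>p q r. eval3 p q r u = 0"
    and v: "dirder d1 d2 d3 v = 0" "dirder e1 e2 e3 v = 0" "\<exists>p q r. eval3 p q r v = 0"
  shows "\<exists>p q r. eval3 p q r u = 0 \<and> eval3 p q r v = 0"
proof -
  obtain q1 q2 q3 where q: "eval3 q1 q2 q3 u = 0" using u(3) by blast
  obtain p1 p2 p3 where p: "eval3 p1 p2 p3 v = 0" using v(3) by blast
  obtain a b c where abc: "q1 = a * d1 + b * e1 + c * f1" "q2 = a * d2 + b * e2 + c * f2" "q3 = a * d3 + b * e3 + c * f3"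
    using cramer3[OF det] by blast
  obtain a' b' c' where abc': "p1 = a' * d1 + b' * e1 + c' * f1" "p2 = a' * d2 + b' * e2 + c' * f2" "p3 = a' * d3 + b' * e3 + c' * f3"
    using cramer3[OF det] by blast
  have "eval3 (a * d1 + b * e1 + c' * f1) (a * d2 + b * e2 + c' * f2) (a * d3 + b * e3 + c' * f3) u = 0"
    using q dirder_zero_eval3[OF u(2), of q1 "c' - c" q2 q3] by (simp add: abc algebra_simps)
  moreover have "eval3 (a' * d1 + b * e1 + c' * f1) (a' * d2 + b * e2 + c' * f2) (a' * d3 + b * e3 + c' * f3) v = 0"
    using p dirder_zero_eval3[OF v(2), of p1 "b - b'" p2 p3] by (simp add: abc' algebra_simps)
  then have "eval3 (a * d1 + b * e1 + c' * f1) (a * d2 + b * e2 + c' * f2) (a * d3 + b * e3 + c' * f3) v = 0"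
    using dirder_zero_eval3[OF v(1), of "a' * d1 + b * e1 + c' * f1" "a - a'" "a' * d2 + b * e2 + c' * f2" "a' * d3 + b * e3 + c' * f3"]
    by (simp add: algebra_simps)
  ultimately show ?thesis by blast
qed

lemma dirder_basis_zero_imp_scalar:
  fixes u :: "'k::field_char_0 poly3"
  assumes det: "det3 d1 d2 d3 e1 e2 e3 f1 f2 f3 \<noteq> 0"
    and u: "dirder d1 d2 d3 u = 0" "dirder e1 e2 e3 u = 0" "dirder f1 f2 f3 u = 0"
  shows "\<exists>c. u = scalar3 c"
proof -
  have "eval3 p q r (u - scalar3 (eval3 0 0 0 u)) = 0" for p q r
  proof -
    obtain a b c where abc: "p = a * d1 + b * e1 + c * f1" "q = a * d2 + b * e2 + c * f2" "r = a * d3 + b * e3 + c * f3"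
      using cramer3[OF det] by blast
    have "eval3 p q r u = eval3 (0 + a * d1 + b * e1) (0 + a * d2 + b * e2) (0 + a * d3 + b * e3) u"
      unfolding abc using dirder_zero_eval3[OF u(3), of "0 + a * d1 + b * e1" c] by simp
    also have "\<dots> = eval3 0 0 0 u" by (simp only: dirder_zero_eval3[OF u(2)] dirder_zero_eval3[OF u(1)])
    finally show ?thesis by (simp add: eval3.hom_minus)
  qed
  then have "u - scalar3 (eval3 0 0 0 u) = 0" using eval3_nonzero by blast
  then show ?thesis by (metis eq_iff_diff_eq_0)
qed

text \<open>
  Record which of the three functions depends on which coordinate. By
  \<open>cylinders_meet_transversally\<close> two functions cannot each depend on the free coordinate of the
  other, and each of them depends on something. This leaves only the two cyclic patterns, in which
  every function depends on a single coordinate, a different one for each; these are excluded by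
  \<open>cylinders_meet_parallel\<close>.
\<close>
lemma no_three_disjoint_cylinders:
  fixes u v w :: "'k::{alg_closed_field, field_char_0} poly3"
  assumes det: "det3 d1 d2 d3 e1 e2 e3 f1 f2 f3 \<noteq> 0"
    and inv: "dirder d1 d2 d3 u = 0" "dirder e1 e2 e3 v = 0" "dirder f1 f2 f3 w = 0"
    and nonconst: "\<And>c. u \<noteq> scalar3 c" "\<And>c. v \<noteq> scalar3 c" "\<And>c. w \<noteq> scalar3 c"
    and uv: "\<not> (\<exists>p q r. eval3 p q r u = 0 \<and> eval3 p q r v = 0)"
    and uw: "\<not> (\<exists>p q r. eval3 p q r u = 0 \<and> eval3 p q r w = 0)"
    and vw: "\<not> (\<exists>p q r. eval3 p q r v = 0 \<and> eval3 p q r w = 0)"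
  shows False
proof -
  have det': "det3 d1 d2 d3 f1 f2 f3 e1 e2 e3 \<noteq> 0" "det3 e1 e2 e3 f1 f2 f3 d1 d2 d3 \<noteq> 0"
    using det by (simp_all add: det3_def algebra_simps)
  have z: "\<exists>p q r. eval3 p q r u = 0" "\<exists>p q r. eval3 p q r v = 0" "\<exists>p q r. eval3 p q r w = 0"
    using nonconst nonconstant_has_zero by blast+
  have 1: "dirder e1 e2 e3 u = 0 \<or> dirder d1 d2 d3 v = 0"
    using cylinders_meet_transversally[OF det inv(1) _ inv(2)] uv by blast
  have 2: "dirder f1 f2 f3 u = 0 \<or> dirder d1 d2 d3 w = 0"
    using cylinders_meet_transversally[OF det'(1) inv(1) _ inv(3)] uw by blast
  have 3: "dirder f1 f2 f3 v = 0 \<or> dirder e1 e2 e3 w = 0"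
    using cylinders_meet_transversally[OF det'(2) inv(2) _ inv(3)] vw by blast
  have 4: "\<not> (dirder e1 e2 e3 u = 0 \<and> dirder f1 f2 f3 u = 0)" "\<not> (dirder d1 d2 d3 v = 0 \<and> dirder f1 f2 f3 v = 0)"
    "\<not> (dirder d1 d2 d3 w = 0 \<and> dirder e1 e2 e3 w = 0)"
    using dirder_basis_zero_imp_scalar[OF det] inv nonconst by blast+
  have 5: "\<not> (dirder f1 f2 f3 u = 0 \<and> dirder d1 d2 d3 v = 0)"
    using cylinders_meet_parallel[OF det inv(1) _ z(1) _ inv(2) z(2)] uv by blast
  have 6: "\<not> (dirder e1 e2 e3 u = 0 \<and> dirder f1 f2 f3 v = 0)"
    using cylinders_meet_parallel[OF det'(2) _ inv(1) z(1) inv(2) _ z(2)] uv by blast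
  show False using 1 2 3 4 5 6 by blast
qed

section \<open>The flow of a nice derivation\<close>

definition monomial3 :: "'k::field \<Rightarrow> nat \<times> nat \<times> nat \<Rightarrow> 'k poly3" where
  "monomial3 c = (\<lambda>(i, j, l). scalar3 c * var_x ^ i * var_y ^ j * var_z ^ l)"

definition coeff3 :: "'k::field poly3 \<Rightarrow> nat \<times> nat \<times> nat \<Rightarrow> 'k" where
  "coeff3 f = (\<lambda>(i, j, l). coeff (coeff (coeff f l) j) i)"

lemma monomial3_monom:
  fixes c :: "'k::field"
  shows "monomial3 c (i, j, l) = monom (monom (monom c i) j) l"
proof -
  have x: "var_x ^ i = [:[:monom (1 :: 'k) i:]:]"
    unfolding var_x_def poly_const_pow x_as_monom x_pow_n ..
  have y: "var_y ^ j = [:monom (1 :: 'k poly) j:]"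
    unfolding var_y_def poly_const_pow x_as_monom x_pow_n ..
  have z: "var_z ^ l = monom (1 :: 'k poly poly) l"
    unfolding var_z_def x_as_monom x_pow_n ..
  show ?thesis by (simp add: monomial3_def x y z scalar3_def smult_monom)
qed

lemma coeff3_monomial3 [simp]: "coeff3 (monomial3 c s) t = (if s = t then c else 0)"
  by (cases s; cases t) (simp add: coeff3_def monomial3_monom)

lemma coeff3_sum: "coeff3 (\<Sum>s\<in>A. F s) t = (\<Sum>s\<in>A. coeff3 (F s) t)"
  by (cases t) (simp add: coeff3_def coeff_sum)

lemma coeff3_eqI: "(\<And>s. coeff3 f s = coeff3 g s) \<Longrightarrow> f = g"
  by (intro poly_eqI) (metis (mono_tags, lifting) case_prod_conv coeff3_def)

lemma finite_support3: "finite {s. coeff3 f s \<noteq> 0}"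
proof (rule finite_subset)
  show "{s. coeff3 f s \<noteq> 0} \<subseteq> (\<lambda>(l, j, i). (i, j, l)) `
      (SIGMA l:{..degree f}. SIGMA j:{..degree (coeff f l)}. {..degree (coeff (coeff f l) j)})"
  proof
    fix s assume "s \<in> {s. coeff3 f s \<noteq> 0}"
    then obtain i j l where s: "s = (i, j, l)" and nz: "coeff (coeff (coeff f l) j) i \<noteq> 0"
      by (cases s) (auto simp: coeff3_def)
    then have "i \<le> degree (coeff (coeff f l) j)" "j \<le> degree (coeff f l)" "l \<le> degree f"
      by (auto intro!: le_degree)
    then show "s \<in> (\<lambda>(l, j, i). (i, j, l)) `
      (SIGMA l:{..degree f}. SIGMA j:{..degree (coeff f l)}. {..degree (coeff (coeff f l) j)})"
      unfolding s by (intro image_eqI[of _ _ "(l, j, i)"]) auto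
  qed
qed auto

lemma monomial3_expansion: "f = (\<Sum>s | coeff3 f s \<noteq> 0. monomial3 (coeff3 f s) s)"
  by (rule coeff3_eqI) (simp add: coeff3_sum sum.delta' finite_support3)

lemma coeff_mult_bounds:
  fixes p q :: "'r::comm_ring_1 poly"
  assumes "degree p \<le> m" "degree q \<le> n"
  shows "coeff (p * q) (m + n) = coeff p m * coeff q n"
proof -
  have "coeff (p * q) (m + n) = (\<Sum>i\<le>m + n. if i = m then coeff p m * coeff q n else 0)"
    unfolding coeff_mult
  proof (rule sum.cong[OF refl])
    fix i assume "i \<in> {..m + n}"
    consider "i = m" | "i > m" | "i < m" by linarith
    then show "coeff p i * coeff q (m + n - i) = (if i = m then coeff p m * coeff q n else 0)"
    proof cases
      case 2
      then show ?thesis using assms by (simp add: coeff_eq_0)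
    next
      case 3
      then have "degree q < m + n - i" using assms by linarith
      then show ?thesis using 3 by (simp add: coeff_eq_0)
    qed simp
  qed
  then show ?thesis by simp
qed

lemma linear_power_bounds:
  fixes u v :: "'r::comm_ring_1"
  shows "degree ([:u, v:] ^ n) \<le> n \<and> coeff ([:u, v:] ^ n) n = v ^ n"
proof (induction n)
  case (Suc n)
  have "degree [:u, v:] \<le> 1" by simp
  then have "degree ([:u, v:] * [:u, v:] ^ n) \<le> 1 + n" "coeff ([:u, v:] * [:u, v:] ^ n) (1 + n) = v * v ^ n"
    using Suc degree_mult_le[of "[:u, v:]" "[:u, v:] ^ n"] coeff_mult_bounds[of "[:u, v:]" 1 "[:u, v:] ^ n" n] by simp_all
  then show ?case by simp
qed simp

locale nice_slice =
  fixes D :: "'k::{alg_closed_field, field_char_0} poly3 \<Rightarrow> 'k poly3" and s :: "'k poly3"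
  assumes derivation: "k_derivation D" and nice: "nice_derivation D" and slice: "D s = 1"
begin

abbreviation "a \<equiv> D var_x"
abbreviation "b \<equiv> D var_y"
abbreviation "c \<equiv> D var_z"

lemma D_along: "derivation_along id D"
  by (rule k_derivation_along[OF derivation])

lemma D_add: "D (f + g) = D f + D g" and D_mult: "D (f * g) = D f * g + f * D g"
  and D_scalar [simp]: "D (scalar3 t) = 0"
  using D_along by (auto simp: derivation_along_def)

lemma D_scalar_mult: "D (scalar3 t * f) = scalar3 t * D f"
  by (simp add: D_mult)

lemma D_0 [simp]: "D 0 = 0"
  using D_scalar[of 0] by (simp add: scalar3_def)

lemma D_minus: "D (- f) = - D f"
  using D_add[of f "- f"] by (simp add: eq_neg_iff_add_eq_0 add.commute)

lemma D_diff: "D (f - g) = D f - D g"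
  using D_add[of f "- g"] by (simp add: D_minus)

lemma D_a [simp]: "D a = 0" and D_b [simp]: "D b = 0" and D_c [simp]: "D c = 0"
  using nice by (simp_all add: nice_derivation_def)

lemma D_gradient: "D f = a * partial_x f + b * partial_y f + c * partial_z f"
proof -
  have i: "comm_ring_hom (id :: 'k poly3 \<Rightarrow> 'k poly3)" using id_hom by (simp add: id_def)
  show ?thesis using derivation_along_gradient[OF i D_along, of f] by simp
qed

text \<open>
  The flow \<open>exp(T D)\<close> as a homomorphism into \<open>k[x,y,z][T]\<close>. It is linear in \<open>T\<close> on the variables
  because \<open>D\<close> is nice.
\<close>
definition flow :: "'k poly3 \<Rightarrow> 'k poly3 poly" where
  "flow = subst3 (\<lambda>t. [:scalar3 t:]) [:var_x, a:] [:var_y, b:] [:var_z, c:]"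

lemma flow_scalar_hom: "comm_ring_hom (\<lambda>t :: 'k. [:scalar3 t:])"
  by (intro comm_ring_hom_comp[OF const_hom scalar3_hom])

lemma flow_hom: "comm_ring_hom flow"
  unfolding flow_def by (intro subst3_hom flow_scalar_hom)

lemma flow_simps [simp]: "flow (scalar3 t) = [:scalar3 t:]" "flow var_x = [:var_x, a:]"
  "flow var_y = [:var_y, b:]" "flow var_z = [:var_z, c:]"
  unfolding flow_def by (simp_all add: subst3_simps flow_scalar_hom)

lemma flow_coeff_0: "coeff (flow f) 0 = f"
proof -
  have "(\<lambda>f. poly (flow f) 0) = (\<lambda>f. f)"
    by (rule poly3_hom_eq[OF comm_ring_hom_comp[OF poly_hom flow_hom] id_hom]) simp_all
  then show ?thesis by (metis poly_0_coeff_0)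
qed

text \<open>
  The differential equation of the flow: differentiation by \<open>T\<close> and \<open>D\<close> applied to the coefficients
  are both derivations along the flow, and they agree on the variables.
\<close>
lemma flow_coeff_Suc: "of_nat (Suc n) * coeff (flow f) (Suc n) = D (coeff (flow f) n)"
proof -
  interpret flow: comm_ring_hom flow by (rule flow_hom)
  have dl: "map_poly D [:u, v:] = [:D u:]" if "D v = 0" for u v
    by (rule poly_eqI) (simp add: that coeff_map_poly coeff_pCons split: nat.split)
  have 1: "derivation_along flow (\<lambda>f. pderiv (flow f))" by (rule pderiv_along[OF flow_hom]) simp
  have 2: "derivation_along flow (\<lambda>f. map_poly D (flow f))"
    by (simp add: derivation_along_def flow.hom_add flow.hom_mult map_poly_mult_derivation[OF D_add D_mult] map_poly_const)
  have "pderiv (flow f) = map_poly D (flow f)"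
    by (rule derivation_along_eq[OF 1 2]) (simp_all add: pderiv_pCons dl)
  then show ?thesis by (metis coeff_pderiv coeff_map_poly D_0)
qed

lemma flow_kernel:
  assumes "D f = 0"
  shows "flow f = [:f:]"
proof -
  have "coeff (flow f) (Suc n) = 0" for n
  proof (induction n)
    case 0
    show ?case using flow_coeff_Suc[of 0 f] assms by (simp add: flow_coeff_0)
  next
    case (Suc n)
    have "of_nat (Suc (Suc n)) * coeff (flow f) (Suc (Suc n)) = 0" using flow_coeff_Suc[of "Suc n" f] Suc by simp
    then show ?case by (metis mult_eq_0_iff of_nat_eq_0_iff nat.distinct(1))
  qed
  then show ?thesis by (intro poly_eqI) (simp add: flow_coeff_0 coeff_pCons split: nat.split)
qed

text \<open>
  The flow of a kernel element has degree zero in \<open>T\<close>, and degrees of factors add up.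
\<close>
lemma kernel_factorially_closed:
  assumes "D (f * g) = 0" "f * g \<noteq> 0"
  shows "D f = 0"
proof -
  interpret flow: comm_ring_hom flow by (rule flow_hom)
  have "flow f * flow g = [:f * g:]" using flow_kernel[OF assms(1)] by (simp add: flow.hom_mult)
  moreover from this have "flow f \<noteq> 0" "flow g \<noteq> 0" using assms(2) by force+
  ultimately have "degree (flow f) = 0" by (metis add_is_0 degree_mult_eq degree_pCons_0)
  then have "coeff (flow f) 1 = 0" by (simp add: coeff_eq_0)
  then show ?thesis using flow_coeff_Suc[of 0 f] by (simp add: flow_coeff_0)
qed

text \<open>
  Let \<open>m\<close> be the total degree of \<open>f\<close>. The coefficient of \<open>T\<^sup>m\<close> in \<open>f(p + T H(p))\<close> is the value of
  the leading form of \<open>f\<close> at \<open>H\<close>; it vanishes because the flow fixes \<open>f\<close>.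
\<close>
lemma leading_form_relation:
  assumes "D f = 0" "\<And>t. f \<noteq> scalar3 t"
  obtains S m \<gamma> where "finite S" "S \<noteq> {}" "\<And>i j l. (i, j, l) \<in> S \<Longrightarrow> i + j + l = m"
    "\<And>s. s \<in> S \<Longrightarrow> \<gamma> s \<noteq> 0"
    "(\<Sum>(i, j, l)\<in>S. scalar3 (\<gamma> (i, j, l)) * a ^ i * b ^ j * c ^ l) = 0"
proof -
  interpret flow: comm_ring_hom flow by (rule flow_hom)
  define T where "T = {s. coeff3 f s \<noteq> 0}"
  define td :: "nat \<times> nat \<times> nat \<Rightarrow> nat" where "td = (\<lambda>(i, j, l). i + j + l)"
  define m where "m = Max (td ` T)"
  have T: "finite T" unfolding T_def by (rule finite_support3)
  have f: "f = (\<Sum>s\<in>T. monomial3 (coeff3 f s) s)" unfolding T_def by (rule monomial3_expansion)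
  have Tne: "T \<noteq> {}"
  proof
    assume "T = {}"
    then have "f = scalar3 0" using f by (simp add: scalar3_def)
    then show False using assms(2) by blast
  qed
  have le: "td s \<le> m" if "s \<in> T" for s using T that unfolding m_def by simp
  have m_in: "m \<in> td ` T" unfolding m_def using T Tne by simp
  have "m > 0"
  proof (rule ccontr)
    assume "\<not> m > 0"
    then have "T \<subseteq> {(0, 0, 0)}" using le by (fastforce simp: td_def)
    then have "T = {(0, 0, 0)}" using Tne by blast
    then have "f = scalar3 (coeff3 f (0, 0, 0))" using f by (simp add: monomial3_def)
    then show False using assms(2) by blast
  qed
  have bounds: "degree (flow (monomial3 t (i, j, l))) \<le> i + j + l \<and>
      coeff (flow (monomial3 t (i, j, l))) (i + j + l) = scalar3 t * a ^ i * b ^ j * c ^ l" for t i j l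
  proof -
    define p q r where "p = smult (scalar3 t) ([:var_x, a:] ^ i)" and "q = [:var_y, b:] ^ j" and "r = [:var_z, c:] ^ l"
    have "flow (monomial3 t (i, j, l)) = (p * q) * r"
      by (simp add: monomial3_def flow.hom_mult flow.hom_power p_def q_def r_def)
    moreover have p: "degree p \<le> i" "coeff p i = scalar3 t * a ^ i"
      using linear_power_bounds[of var_x a i] degree_smult_le order_trans unfolding p_def by (blast, simp)
    moreover have q: "degree q \<le> j" "coeff q j = b ^ j"
      and r: "degree r \<le> l" "coeff r l = c ^ l"
      using linear_power_bounds unfolding q_def r_def by blast+
    moreover have "degree (p * q) \<le> i + j" using degree_mult_le[of p q] p q by linarith
    moreover from this have "degree (p * q * r) \<le> i + j + l" using degree_mult_le[of "p * q" r] r by linarith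
    ultimately show ?thesis by (simp add: coeff_mult_bounds)
  qed
  have cb: "coeff (flow (monomial3 t s)) m = (if td s = m then (case s of (i, j, l) \<Rightarrow> scalar3 t * a ^ i * b ^ j * c ^ l) else 0)"
    if "td s \<le> m" for s t
  proof (cases s)
    case (fields i j l)
    show ?thesis
    proof (cases "i + j + l = m")
      case True
      then show ?thesis using bounds[of t i j l] by (simp add: fields td_def)
    next
      case False
      then have "degree (flow (monomial3 t s)) < m" using that bounds[of t i j l] by (simp add: fields td_def)
      then show ?thesis using False by (simp add: fields td_def coeff_eq_0)
    qed
  qed
  have "coeff (flow f) m = 0"
    using flow_kernel[OF assms(1)] \<open>m > 0\<close> by (simp add: coeff_pCons split: nat.split)
  also have "coeff (flow f) m = (\<Sum>s\<in>T. coeff (flow (monomial3 (coeff3 f s) s)) m)"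
    by (subst f) (simp add: flow.hom_sum coeff_sum)
  also have "\<dots> = (\<Sum>s\<in>T. if td s = m then (case s of (i, j, l) \<Rightarrow> scalar3 (coeff3 f s) * a ^ i * b ^ j * c ^ l) else 0)"
    by (intro sum.cong refl cb le)
  also have "\<dots> = (\<Sum>s\<in>{s \<in> T. td s = m}. case s of (i, j, l) \<Rightarrow> scalar3 (coeff3 f s) * a ^ i * b ^ j * c ^ l)"
    by (simp add: sum.inter_filter[OF T])
  finally have "(\<Sum>(i, j, l)\<in>{s \<in> T. td s = m}. scalar3 (coeff3 f (i, j, l)) * a ^ i * b ^ j * c ^ l) = 0"
    by (simp add: case_prod_unfold)
  then show ?thesis
    by (rule that[rotated 4]) (use T m_in in \<open>auto simp: T_def td_def\<close>)
qed

end

section \<open>Linear dependence of the three components\<close>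

text \<open>
  The value at \<open>(u, v)\<close> of the binary form of degree \<open>m\<close> that dehomogenizes to \<open>p\<close>; it is meant for
  \<open>degree p \<le> m\<close>.
\<close>
definition homogenize :: "nat \<Rightarrow> 'k::field poly \<Rightarrow> 'k poly3 \<Rightarrow> 'k poly3 \<Rightarrow> 'k poly3" where
  "homogenize m p u v = (\<Sum>r\<le>m. scalar3 (coeff p r) * u ^ r * v ^ (m - r))"

lemma homogenize_sum: "homogenize m (\<Sum>i\<in>A. p i) u v = (\<Sum>i\<in>A. homogenize m (p i) u v)"
  unfolding homogenize_def coeff_sum scalar3.hom_sum sum_distrib_right by (rule sum.swap)

lemma homogenize_linear_mult:
  assumes "degree p \<le> m"
  shows "homogenize (Suc m) ([:\<alpha>, \<beta>:] * p) u v = (scalar3 \<alpha> * v + scalar3 \<beta> * u) * homogenize m p u v"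
proof -
  have "homogenize (Suc m) ([:\<alpha>, \<beta>:] * p) u v =
      (\<Sum>r\<le>Suc m. scalar3 \<alpha> * scalar3 (coeff p r) * u ^ r * v ^ (Suc m - r)) +
      (\<Sum>r\<le>Suc m. scalar3 \<beta> * scalar3 (coeff (pCons 0 p) r) * u ^ r * v ^ (Suc m - r))"
    unfolding homogenize_def sum.distrib[symmetric]
    by (intro sum.cong refl)
      (simp add: scalar3.hom_add scalar3.hom_mult coeff_pCons algebra_simps split: nat.split)
  also have "(\<Sum>r\<le>Suc m. scalar3 \<alpha> * scalar3 (coeff p r) * u ^ r * v ^ (Suc m - r)) = scalar3 \<alpha> * v * homogenize m p u v"
    using assms by (simp add: homogenize_def sum_distrib_left coeff_eq_0 Suc_diff_le algebra_simps cong: sum.cong_simp)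
  also have "(\<Sum>r\<le>Suc m. scalar3 \<beta> * scalar3 (coeff (pCons 0 p) r) * u ^ r * v ^ (Suc m - r)) = scalar3 \<beta> * u * homogenize m p u v"
    unfolding sum.atMost_Suc_shift by (simp add: homogenize_def sum_distrib_left algebra_simps)
  finally show ?thesis by (simp add: algebra_simps)
qed

lemma homogenize_linear_power_mult:
  assumes "degree p \<le> m"
  shows "degree ([:\<alpha>, \<beta>:] ^ n * p) \<le> n + m \<and> homogenize (n + m) ([:\<alpha>, \<beta>:] ^ n * p) u v = 
    (scalar3 \<alpha> * v + scalar3 \<beta> * u) ^ n * homogenize m p u v"
proof (induction n)
  case (Suc n)
  define q where "q = [:\<alpha>, \<beta>:] ^ n * p"
  have q: "[:\<alpha>, \<beta>:] ^ Suc n * p = [:\<alpha>, \<beta>:] * q" by (simp only: q_def power_Suc mult.assoc)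
  have IH: "degree q \<le> n + m" "homogenize (n + m) q u v = (scalar3 \<alpha> * v + scalar3 \<beta> * u) ^ n * homogenize m p u v"
    using Suc by (simp_all only: q_def)
  have "degree [:\<alpha>, \<beta>:] \<le> 1" by simp
  then have "degree ([:\<alpha>, \<beta>:] * q) \<le> Suc n + m"
    using IH(1) degree_mult_le[of "[:\<alpha>, \<beta>:]" q] by linarith
  then show ?case
    unfolding q add_Suc homogenize_linear_mult[OF IH(1)] IH(2) by (simp only: power_Suc mult.assoc simp_thms)
qed (use assms in simp)

lemma scalar3_unit: "t \<noteq> 0 \<Longrightarrow> scalar3 t dvd (1 :: 'k::field poly3)"
  by (rule dvdI[of _ _ "scalar3 (inverse t)"]) (simp flip: scalar3.hom_mult)

lemma unit_imp_scalar3: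
  fixes f :: "'k::field poly3"
  assumes "f dvd 1"
  obtains t where "f = scalar3 t" "t \<noteq> 0"
proof -
  from assms obtain f1 where f1: "f = [:f1:]" "f1 dvd 1" by (auto simp: is_unit_poly_iff)
  then obtain f2 where f2: "f1 = [:f2:]" "f2 dvd 1" by (auto simp: is_unit_poly_iff)
  then obtain t where "f2 = [:t:]" "t \<noteq> 0"
    by (metis degree_eq_zeroE is_unit_iff_degree not_is_unit_0 pCons_0_0)
  then show ?thesis using that[of t] f1 f2 by (auto simp: scalar3_def)
qed

text \<open>
  Over an algebraically closed field a binary form is a product of linear forms, so a prime divisor
  of its value divides the value of one of them.
\<close>
lemma prime_dvd_binary_form:
  fixes w u v :: "'k::alg_closed_field poly3"
  assumes w: "prime_elem w"
  shows "p \<noteq> 0 \<Longrightarrow> degree p \<le> m \<Longrightarrow> w dvd homogenize m p u v \<Longrightarrow> w dvd v \<or> (\<exists>t. w dvd u - scalar3 t * v)"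
proof (induction m arbitrary: p)
  case 0
  then have "coeff p 0 \<noteq> 0" by (auto elim: degree_eq_zeroE)
  then have "w dvd 1" using scalar3_unit[of "coeff p 0"] 0 by (auto simp: homogenize_def intro: dvd_trans)
  then show ?case using w by (simp add: prime_elem_def)
next
  case (Suc m)
  show ?case
  proof (cases "degree p \<le> m")
    case True
    have "homogenize (Suc m) p u v = v * homogenize m p u v"
      using homogenize_linear_mult[OF True, of 1 0 u v] by simp
    then show ?thesis using Suc True w prime_elem_dvd_multD by metis
  next
    case False
    then have "degree p > 0" by simp
    then obtain t where "poly p t = 0" using alg_closed_imp_poly_has_root by blast
    then obtain q where q: "p = [:- t, 1:] * q" by (metis poly_eq_0_iff_dvd dvdE)
    then have "q \<noteq> 0" using Suc.prems by auto
    then have dq: "degree q \<le> m" using Suc.prems unfolding q by (subst (asm) degree_mult_eq) auto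
    have "homogenize (Suc m) p u v = (u - scalar3 t * v) * homogenize m q u v"
      unfolding q homogenize_linear_mult[OF dq] by (simp add: scalar3.hom_uminus)
    then show ?thesis using Suc.IH[OF \<open>q \<noteq> 0\<close> dq] Suc.prems w prime_elem_dvd_multD by metis
  qed
qed

lemma dvd_diff_power:
  fixes x y :: "'r::comm_ring_1"
  shows "w dvd x - y \<Longrightarrow> w dvd x ^ n - y ^ n"
proof (induction n)
  case (Suc n)
  have "x ^ Suc n - y ^ Suc n = x * (x ^ n - y ^ n) + (x - y) * y ^ n" by (simp add: algebra_simps)
  then show ?case using Suc by (metis dvd_add dvd_mult dvd_mult2)
qed simp

context nice_slice
begin

text \<open>
  Modulo \<open>w\<close> the vector \<open>(a, b, c)\<close> is a multiple of the constant vector \<open>(d1, d2, d3)\<close>. On the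
  surface \<open>w = 0\<close> all flow lines then have this direction.
\<close>
definition directed :: "'k poly3 \<Rightarrow> 'k \<Rightarrow> 'k \<Rightarrow> 'k \<Rightarrow> bool" where
  "directed w d1 d2 d3 \<longleftrightarrow> w \<noteq> 0 \<and> \<not> w dvd 1 \<and> D w = 0 \<and> (d1 \<noteq> 0 \<or> d2 \<noteq> 0 \<or> d3 \<noteq> 0) \<and>
     (\<exists>g. w dvd a - scalar3 d1 * g \<and> w dvd b - scalar3 d2 * g \<and> w dvd c - scalar3 d3 * g)"

text \<open>
  Modulo \<open>w\<close>, \<open>D\<close> is \<open>g\<close> times the derivative along \<open>d\<close>. Applied to the slice this shows that \<open>g\<close> is
  invertible modulo \<open>w\<close>; applied to \<open>w\<close> it shows that \<open>w\<close> divides its derivative along \<open>d\<close>.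
\<close>
lemma directed_imp_cylinder:
  assumes "directed w d1 d2 d3"
  shows "dirder d1 d2 d3 w = 0"
proof -
  obtain g where g: "w dvd a - scalar3 d1 * g" "w dvd b - scalar3 d2 * g" "w dvd c - scalar3 d3 * g"
    using assms by (auto simp: directed_def)
  have "w dvd D f - g * dirder d1 d2 d3 f" for f
  proof -
    have "D f - g * dirder d1 d2 d3 f = (a - scalar3 d1 * g) * partial_x f + (b - scalar3 d2 * g) * partial_y f
      + (c - scalar3 d3 * g) * partial_z f"
      by (subst D_gradient) (simp add: dirder_def algebra_simps)
    then show ?thesis using g by simp
  qed
  from this[of w] this[of s] have "w dvd - (g * dirder d1 d2 d3 w)" "w dvd 1 - g * dirder d1 d2 d3 s"
    using assms by (simp_all only: directed_def slice diff_0)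
  from dvd_diff[OF dvd_mult2[OF this(2)] dvd_mult2[OF this(1)]]
  have "w dvd (1 - g * dirder d1 d2 d3 s) * dirder d1 d2 d3 w - - (g * dirder d1 d2 d3 w) * dirder d1 d2 d3 s" .
  moreover have "(1 - g * dirder d1 d2 d3 s) * dirder d1 d2 d3 w - - (g * dirder d1 d2 d3 w) * dirder d1 d2 d3 s
      = dirder d1 d2 d3 w" by (simp add: algebra_simps)
  ultimately have "w dvd dirder d1 d2 d3 w" by (simp only:)
  then show ?thesis by (rule dvd_dirder_imp_zero)
qed

text \<open>
  At a common zero \<open>(a, b, c)\<close> would be proportional to both directions, hence zero, which the slice
  forbids. The determinant with a third vector expresses the independence of the two directions.
\<close>
lemma directed_disjoint:
  assumes "directed u d1 d2 d3" "directed v e1 e2 e3" and det: "det3 d1 d2 d3 e1 e2 e3 f1 f2 f3 \<noteq> 0"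
  shows "\<not> (\<exists>p q r. eval3 p q r u = 0 \<and> eval3 p q r v = 0)"
proof
  assume "\<exists>p q r. eval3 p q r u = 0 \<and> eval3 p q r v = 0"
  then obtain p q r where z: "eval3 p q r u = 0" "eval3 p q r v = 0" by blast
  let ?e = "eval3 p q r"
  have *: "\<exists>\<gamma>. ?e a = d1 * \<gamma> \<and> ?e b = d2 * \<gamma> \<and> ?e c = d3 * \<gamma>" if w: "directed w d1 d2 d3" "?e w = 0" for w d1 d2 d3
  proof -
    obtain g where g: "w dvd a - scalar3 d1 * g" "w dvd b - scalar3 d2 * g" "w dvd c - scalar3 d3 * g"
      using w by (auto simp: directed_def)
    have "?e f = 0" if "w dvd f" for f using that w(2) by (elim dvdE) (simp add: eval3.hom_mult)
    from this[OF g(1)] this[OF g(2)] this[OF g(3)] show ?thesis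
      by (intro exI[of _ "?e g"]) (simp add: eval3.hom_minus eval3.hom_mult)
  qed
  obtain \<gamma> where \<gamma>: "?e a = d1 * \<gamma>" "?e b = d2 * \<gamma>" "?e c = d3 * \<gamma>" using *[OF assms(1) z(1)] by blast
  obtain \<gamma>' where \<gamma>': "?e a = e1 * \<gamma>'" "?e b = e2 * \<gamma>'" "?e c = e3 * \<gamma>'" using *[OF assms(2) z(2)] by blast
  have "?e (D s) = 1" by (simp add: slice)
  then have "?e a \<noteq> 0 \<or> ?e b \<noteq> 0 \<or> ?e c \<noteq> 0"
    by (subst (asm) D_gradient) (auto simp: eval3.hom_add eval3.hom_mult)
  then have nz: "\<gamma> \<noteq> 0" "\<gamma>' \<noteq> 0" using \<gamma> \<gamma>' by auto
  have "\<gamma> * \<gamma>' * det3 d1 d2 d3 e1 e2 e3 f1 f2 f3 =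
      det3 (d1 * \<gamma>) (d2 * \<gamma>) (d3 * \<gamma>) (e1 * \<gamma>') (e2 * \<gamma>') (e3 * \<gamma>') f1 f2 f3"
    by (simp add: det3_def algebra_simps)
  also have "\<dots> = 0" unfolding \<gamma>[symmetric] \<gamma>'[symmetric] by (simp add: det3_def algebra_simps)
  finally show False using nz det by simp
qed

lemma directed_nonscalar: "directed w d1 d2 d3 \<Longrightarrow> w \<noteq> scalar3 t"
  using scalar3_unit[of t] by (cases "t = 0") (auto simp: directed_def)

lemma directed_coplanar:
  assumes "directed u d1 d2 d3" "directed v e1 e2 e3" "directed w f1 f2 f3"
  shows "det3 d1 d2 d3 e1 e2 e3 f1 f2 f3 = 0"
proof (rule ccontr)
  assume det: "det3 d1 d2 d3 e1 e2 e3 f1 f2 f3 \<noteq> 0"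
  have det': "det3 d1 d2 d3 f1 f2 f3 e1 e2 e3 \<noteq> 0" "det3 e1 e2 e3 f1 f2 f3 d1 d2 d3 \<noteq> 0"
    using det by (simp_all add: det3_def algebra_simps)
  show False
    by (rule no_three_disjoint_cylinders[OF det directed_imp_cylinder[OF assms(1)]
      directed_imp_cylinder[OF assms(2)] directed_imp_cylinder[OF assms(3)]
      directed_nonscalar[OF assms(1)] directed_nonscalar[OF assms(2)] directed_nonscalar[OF assms(3)]
      directed_disjoint[OF assms(1,2) det] directed_disjoint[OF assms(1,3) det'(1)]
      directed_disjoint[OF assms(2,3) det'(2)]])
qed

text \<open>
  If two of the directions are independent, their cross product is the normal vector, since any
  third direction has zero determinant with them; otherwise all directions are proportional.
\<close>
lemma directed_plane:
  obtains m1 m2 m3 where "m1 \<noteq> 0 \<or> m2 \<noteq> 0 \<or> m3 \<noteq> 0"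
    "\<And>w d1 d2 d3. directed w d1 d2 d3 \<Longrightarrow> m1 * d1 + m2 * d2 + m3 * d3 = 0"
proof (cases "\<exists>w d1 d2 d3. directed w d1 d2 d3")
  case False
  then show ?thesis using that[of 1 0 0] by simp
next
  case True
  then obtain u d1 d2 d3 where u: "directed u d1 d2 d3" by blast
  define m where "m = (\<lambda>e1 e2 e3. (d2 * e3 - d3 * e2, d3 * e1 - d1 * e3, d1 * e2 - d2 * e1))"
  show ?thesis
  proof (cases "\<exists>v e1 e2 e3. directed v e1 e2 e3 \<and> m e1 e2 e3 \<noteq> (0, 0, 0)")
    case True
    then obtain v e1 e2 e3 where v: "directed v e1 e2 e3" "m e1 e2 e3 \<noteq> (0, 0, 0)" by blast
    show ?thesis
    proof (rule that)
      show "d2 * e3 - d3 * e2 \<noteq> 0 \<or> d3 * e1 - d1 * e3 \<noteq> 0 \<or> d1 * e2 - d2 * e1 \<noteq> 0"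
        using v(2) by (auto simp: m_def)
      show "(d2 * e3 - d3 * e2) * f1 + (d3 * e1 - d1 * e3) * f2 + (d1 * e2 - d2 * e1) * f3 = 0"
        if "directed w f1 f2 f3" for w f1 f2 f3
        using directed_coplanar[OF u v(1) that] by (simp add: det3_def algebra_simps)
    qed
  next
    case False
    then have par: "d2 * e3 = d3 * e2" "d3 * e1 = d1 * e3" "d1 * e2 = d2 * e1" if "directed v e1 e2 e3" for v e1 e2 e3
      using that by (auto simp: m_def)
    show ?thesis
    proof (cases "d1 = 0 \<and> d2 = 0")
      case True
      then have "d3 \<noteq> 0" using u by (auto simp: directed_def)
      then show ?thesis using that[of 1 0 0] par(2) True by force
    next
      case False
      then show ?thesis using that[of "- d2" d1 0] par(3) by auto
    qed
  qed
qed

lemma exists_nonscalar_kernel_element: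
  assumes indep: "\<And>l1 l2 l3. scalar3 l1 * a + scalar3 l2 * b + scalar3 l3 * c = 0 \<Longrightarrow> l1 = 0 \<and> l2 = 0 \<and> l3 = 0"
  obtains f where "D f = 0" "\<And>t. f \<noteq> scalar3 t"
proof (rule ccontr)
  assume n: "\<not> thesis"
  have "\<exists>t. a = scalar3 t" "\<exists>t. b = scalar3 t" using n that[OF D_a] that[OF D_b] by blast+
  then obtain \<alpha> \<beta> where ab: "a = scalar3 \<alpha>" "b = scalar3 \<beta>" by blast
  have "scalar3 \<beta> * a + scalar3 (- \<alpha>) * b + scalar3 0 * c = 0" by (simp add: ab scalar3.hom_uminus)
  then have "\<alpha> = 0" using indep by fastforce
  then have "scalar3 1 * a + scalar3 0 * b + scalar3 0 * c = 0" by (simp add: ab)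
  then show False using indep by fastforce
qed

text \<open>
  The linear forms \<open>(t\<^sup>2, t, 1)\<close> are in general position: any three of them are independent.
\<close>
abbreviation "pencil t \<equiv> scalar3 (t ^ 2) * a + scalar3 t * b + c"

text \<open>
  Modulo a factor \<open>w\<close> of \<open>pencil t\<close>, the component \<open>c\<close> is congruent to \<open>- t b - t\<^sup>2 a\<close>. Substituting
  this in the relation \<open>F(a, b, c) = 0\<close> yields a binary form in \<open>a\<close> and \<open>b\<close> that is divisible by \<open>w\<close>.
  The exceptional set consists of those \<open>t\<close> for which this binary form is identically zero.
\<close>
lemma prime_factors_of_pencil_directed:
  assumes "D f = 0" "\<And>t. f \<noteq> scalar3 t"
  obtains B where "finite B"
    "\<And>t w. t \<notin> B \<Longrightarrow> irreducible w \<Longrightarrow> w dvd pencil t \<Longrightarrow> pencil t \<noteq> 0 \<Longrightarrow> \<exists>d1 d2 d3. directed w d1 d2 d3"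
proof -
  obtain S m \<gamma> where S: "finite S" "S \<noteq> {}" "\<And>i j l. (i, j, l) \<in> S \<Longrightarrow> i + j + l = m"
    and \<gamma>: "\<And>s. s \<in> S \<Longrightarrow> \<gamma> s \<noteq> 0"
    and rel: "(\<Sum>(i, j, l)\<in>S. scalar3 (\<gamma> (i, j, l)) * a ^ i * b ^ j * c ^ l) = 0"
    by (rule leading_form_relation[OF assms]) blast
  \<comment> \<open>The form dehomogenized at \<open>Y = 1\<close>; it stays nonzero, as \<open>i\<close> and \<open>l\<close> determine \<open>j = m - i - l\<close>.\<close>
  define F where "F = (\<Sum>(i, j, l)\<in>S. monom (monom (\<gamma> (i, j, l)) i) l)"
  obtain i0 j0 l0 where s0: "(i0, j0, l0) \<in> S" using S(2) by auto
  have "coeff (coeff F l0) i0 = (\<Sum>s\<in>S. if s = (i0, j0, l0) then \<gamma> (i0, j0, l0) else 0)"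
    unfolding F_def coeff_sum
  proof (rule sum.cong[OF refl], clarify)
    fix i j l assume "(i, j, l) \<in> S"
    then have "(i, j, l) = (i0, j0, l0) \<longleftrightarrow> i = i0 \<and> l = l0" using S(3)[of i j l] S(3)[OF s0] by auto
    then show "coeff (coeff (monom (monom (\<gamma> (i, j, l)) i) l) l0) i0 = (if (i, j, l) = (i0, j0, l0) then \<gamma> (i0, j0, l0) else 0)"
      by auto
  qed
  also have "\<dots> = \<gamma> (i0, j0, l0)" using S(1) s0 by simp
  finally have "F \<noteq> 0" using \<gamma>[OF s0] by auto
  define B where "B = {t. poly F [:- t, - (t ^ 2):] = 0}"
  have "finite B"
  proof (rule finite_imageD)
    show "finite ((\<lambda>t. [:- t, - (t ^ 2):]) ` B)"
      by (rule finite_subset[OF _ poly_roots_finite[OF \<open>F \<noteq> 0\<close>]]) (auto simp: B_def)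
    show "inj_on (\<lambda>t. [:- t, - (t ^ 2):]) B" by (auto simp: inj_on_def)
  qed
  moreover have "\<exists>d1 d2 d3. directed w d1 d2 d3"
    if t: "t \<notin> B" and w: "irreducible w" "w dvd pencil t" and nz: "pencil t \<noteq> 0" for t w
  proof -
    have pw: "prime_elem w" using w by simp
    define e where "e = scalar3 (- t) * b + scalar3 (- (t ^ 2)) * a"
    define p where "p = poly F [:- t, - (t ^ 2):]"
    have "p \<noteq> 0" using t by (simp add: B_def p_def)
    have p: "p = (\<Sum>(i, j, l)\<in>S. [:0, 1:] ^ i * ([:- t, - (t ^ 2):] ^ l * [:\<gamma> (i, j, l):]))"
      unfolding p_def F_def poly_sum
      by (intro sum.cong refl) (auto simp: poly_monom monom_altdef)
    have tm: "degree ([:0, 1:] ^ i * ([:- t, - (t ^ 2):] ^ l * [:g:])) \<le> m \<and>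
        homogenize m ([:0, 1:] ^ i * ([:- t, - (t ^ 2):] ^ l * [:g:])) a b = scalar3 g * a ^ i * b ^ j * e ^ l"
      if "i + j + l = m" for i j l g
    proof -
      have 0: "degree [:g:] \<le> j" "homogenize j [:g:] a b = scalar3 g * b ^ j"
        by (simp_all add: homogenize_def coeff_pCons sum.atMost_shift split: nat.split)
      note 1 = homogenize_linear_power_mult[OF 0(1), of "- t" "- (t ^ 2)" l a b]
      note 2 = homogenize_linear_power_mult[OF conjunct1[OF 1], of 0 1 i a b]
      have m: "i + (l + j) = m" using that by simp
      show ?thesis using 1 2 unfolding m 0(2) e_def by (simp add: mult_ac)
    qed
    have dp: "degree p \<le> m" unfolding p
    proof (rule degree_sum_le[OF S(1)])
      fix q assume "q \<in> S"
      moreover obtain i j l where "q = (i, j, l)" by (cases q)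
      ultimately show "degree (case q of (i, j, l) \<Rightarrow> [:0, 1:] ^ i * ([:- t, - (t ^ 2):] ^ l * [:\<gamma> (i, j, l):])) \<le> m"
        using tm[OF S(3)] by (simp only: prod.case)
    qed
    have "homogenize m p a b = (\<Sum>(i, j, l)\<in>S. scalar3 (\<gamma> (i, j, l)) * a ^ i * b ^ j * e ^ l)"
      unfolding p homogenize_sum
      by (intro sum.cong refl) (use tm S(3) in auto)
    also have "\<dots> = (\<Sum>(i, j, l)\<in>S. - (scalar3 (\<gamma> (i, j, l)) * a ^ i * b ^ j * (c ^ l - e ^ l)))"
      by (subst diff_0_right[symmetric], subst rel[symmetric])
        (simp add: sum_subtractf[symmetric] case_prod_unfold algebra_simps)
    also have "w dvd \<dots>"
    proof (rule dvd_sum, clarify)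
      fix i j l assume "(i, j, l) \<in> S"
      have "w dvd c - e" using w(2) by (simp add: e_def scalar3.hom_uminus algebra_simps)
      then have "w dvd c ^ l - e ^ l" by (rule dvd_diff_power)
      then show "w dvd - (scalar3 (\<gamma> (i, j, l)) * a ^ i * b ^ j * (c ^ l - e ^ l))"
        by (simp only: dvd_minus_iff dvd_mult)
    qed
    finally have "w dvd homogenize m p a b" .
    from prime_dvd_binary_form[OF pw \<open>p \<noteq> 0\<close> dp this]
    consider "w dvd b" | \<tau> where "w dvd a - scalar3 \<tau> * b" by blast
    then have "\<exists>d1 d2 d3. (d1 \<noteq> 0 \<or> d2 \<noteq> 0 \<or> d3 \<noteq> 0) \<and>
      (\<exists>g. w dvd a - scalar3 d1 * g \<and> w dvd b - scalar3 d2 * g \<and> w dvd c - scalar3 d3 * g)"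
    proof cases
      case 1
      have eq: "c - scalar3 (- (t ^ 2)) * a = pencil t - scalar3 t * b" by (simp add: scalar3.hom_uminus)
      have "w dvd a - scalar3 1 * a" "w dvd b - scalar3 0 * a" using 1 by simp_all
      moreover have "w dvd c - scalar3 (- (t ^ 2)) * a" unfolding eq by (rule dvd_diff[OF w(2) dvd_mult[OF 1]])
      ultimately show ?thesis by (metis zero_neq_one)
    next
      case 2
      have eq: "c - scalar3 (- t - t ^ 2 * \<tau>) * b = pencil t - scalar3 (t ^ 2) * (a - scalar3 \<tau> * b)"
        by (simp add: scalar3.hom_uminus scalar3.hom_minus scalar3.hom_mult algebra_simps)
      have "w dvd b - scalar3 1 * b" by simp
      moreover have "w dvd c - scalar3 (- t - t ^ 2 * \<tau>) * b" unfolding eq by (rule dvd_diff[OF w(2) dvd_mult[OF 2]])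
      ultimately show ?thesis using 2 by (metis zero_neq_one)
    qed
    moreover have "D w = 0"
    proof -
      obtain v where v: "pencil t = w * v" using w(2) by (elim dvdE)
      have "D (pencil t) = 0" by (simp add: D_add D_scalar_mult)
      then show ?thesis using kernel_factorially_closed[of w v] nz unfolding v by blast
    qed
    moreover have "w \<noteq> 0" "\<not> w dvd 1" using w(1) by (auto simp: irreducible_def)
    ultimately show ?thesis unfolding directed_def by blast
  qed
  ultimately show ?thesis using that by blast
qed

text \<open>
  A common divisor of three members of the pencil divides \<open>a\<close>, \<open>b\<close> and \<open>c\<close>, hence \<open>D s = 1\<close>.
\<close>
lemma finite_dvd_pencil:
  assumes "\<not> e dvd 1"
  shows "finite {t. e dvd pencil t}"
proof (rule ccontr)
  assume inf: "infinite {t. e dvd pencil t}"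
  have ex: "\<exists>t. e dvd pencil t \<and> t \<notin> A" if "finite A" for A
    using inf finite_subset[OF _ that, of "{t. e dvd pencil t}"] by blast
  obtain t where t: "e dvd pencil t" using ex[of "{}"] by blast
  obtain u where u: "e dvd pencil u" "u \<noteq> t" using ex[of "{t}"] by blast
  obtain v where "e dvd pencil v \<and> v \<notin> {t, u}" using ex[of "{t, u}"] by blast
  then have v: "e dvd pencil v" "v \<noteq> t" "v \<noteq> u" by auto
  have cancel: "e dvd f" if "e dvd scalar3 r * f" "r \<noteq> 0" for r f
  proof -
    have "f = scalar3 (inverse r) * (scalar3 r * f)" using that(2) by (simp flip: scalar3.hom_mult mult.assoc)
    then show ?thesis using that(1) by (metis dvd_mult)
  qed
  have step: "e dvd scalar3 (p + t) * a + b" if "e dvd pencil p" "p \<noteq> t" for p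
  proof (rule cancel)
    have "scalar3 (p - t) * (scalar3 (p + t) * a + b) = pencil p - pencil t"
      by (simp add: scalar3.hom_minus scalar3.hom_add scalar3.hom_mult power2_eq_square algebra_simps)
    then show "e dvd scalar3 (p - t) * (scalar3 (p + t) * a + b)" using that t by (metis dvd_diff)
  qed (use that in simp)
  have ea: "e dvd a"
  proof (rule cancel)
    have "scalar3 (u - v) * a = (scalar3 (u + t) * a + b) - (scalar3 (v + t) * a + b)"
      by (simp add: scalar3.hom_minus scalar3.hom_add algebra_simps)
    then show "e dvd scalar3 (u - v) * a" using step u v by (metis dvd_diff)
  qed (use v in simp)
  then have eb: "e dvd b" using step[OF u] by (metis dvd_add_right_iff dvd_mult)
  then have ec: "e dvd c" using t ea by (metis dvd_add dvd_add_right_iff dvd_mult)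
  have "e dvd D s" unfolding D_gradient[of s] using ea eb ec by simp
  then show False using assms by (simp add: slice)
qed

text \<open>
  The normal vector of \<open>directed_plane\<close> gives a combination \<open>M\<close> of \<open>a\<close>, \<open>b\<close>, \<open>c\<close> that is divisible by
  every directed \<open>w\<close>. If \<open>M\<close> is not zero, unique factorization leaves finitely many candidates for
  \<open>w\<close> up to units, so almost all members of the pencil have no prime factor and are constants.
\<close>
lemma components_linearly_dependent:
  obtains l1 l2 l3 where "l1 \<noteq> 0 \<or> l2 \<noteq> 0 \<or> l3 \<noteq> 0" "scalar3 l1 * a + scalar3 l2 * b + scalar3 l3 * c = 0"
proof (rule ccontr)
  assume n: "\<not> thesis"
  note witness = that
  have indep: "l1 = 0 \<and> l2 = 0 \<and> l3 = 0" if "scalar3 l1 * a + scalar3 l2 * b + scalar3 l3 * c = 0" for l1 l2 l3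
    using n witness[OF _ that] by blast
  obtain f where f: "D f = 0" "\<And>t. f \<noteq> scalar3 t" using exists_nonscalar_kernel_element indep by blast
  obtain B where B: "finite B" "\<And>t w. t \<notin> B \<Longrightarrow> irreducible w \<Longrightarrow> w dvd pencil t \<Longrightarrow> pencil t \<noteq> 0 \<Longrightarrow>
    \<exists>d1 d2 d3. directed w d1 d2 d3"
    using prime_factors_of_pencil_directed[OF f] by metis
  have nz: "pencil t \<noteq> 0" for t using indep[of "t ^ 2" t 1] by auto
  obtain m1 m2 m3 where m: "m1 \<noteq> 0 \<or> m2 \<noteq> 0 \<or> m3 \<noteq> 0"
    and plane: "\<And>w d1 d2 d3. directed w d1 d2 d3 \<Longrightarrow> m1 * d1 + m2 * d2 + m3 * d3 = 0"
    using directed_plane by blast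
  define M where "M = scalar3 m1 * a + scalar3 m2 * b + scalar3 m3 * c"
  have "M \<noteq> 0" using indep m unfolding M_def by blast
  have dvdM: "w dvd M" if dir: "directed w d1 d2 d3" for w d1 d2 d3
  proof -
    obtain g where g: "w dvd a - scalar3 d1 * g" "w dvd b - scalar3 d2 * g" "w dvd c - scalar3 d3 * g"
      using dir by (auto simp: directed_def)
    have "M = scalar3 m1 * (a - scalar3 d1 * g) + scalar3 m2 * (b - scalar3 d2 * g) + scalar3 m3 * (c - scalar3 d3 * g)
      + scalar3 (m1 * d1 + m2 * d2 + m3 * d3) * g"
      by (simp add: M_def scalar3.hom_add scalar3.hom_mult algebra_simps)
    then show ?thesis unfolding plane[OF dir] using g by simp
  qed
  define U where "U = {t. \<not> pencil t dvd 1}"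
  have factor: "\<exists>w. irreducible w \<and> w dvd pencil t" if "t \<in> U" for t
  proof -
    have "\<not> pencil t dvd 1" using that by (simp add: U_def)
    then obtain F where F: "mset_factors F (pencil t)" using mset_factors_exist[OF nz] by blast
    then obtain e where "e \<in># F" by (auto simp: mset_factors_def)
    moreover from this have "irreducible e" using F by (simp add: mset_factors_def)
    ultimately show ?thesis using mset_factors_imp_dvd[OF F] by blast
  qed
  have "finite (U - B)"
  proof (cases "M dvd 1")
    case True
    have "U - B = {}"
    proof (rule ccontr)
      assume "U - B \<noteq> {}"
      then obtain t w where "t \<notin> B" "irreducible w" "w dvd pencil t" using factor by blast
      then obtain d1 d2 d3 where d: "directed w d1 d2 d3" using B(2) nz by blast
      then show False using dvdM[OF d] True by (auto simp: directed_def dest: dvd_trans)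
    qed
    then show ?thesis by (simp only: finite.emptyI)
  next
    case False
    then obtain F where F: "mset_factors F M" using mset_factors_exist \<open>M \<noteq> 0\<close> by blast
    have "U - B \<subseteq> (\<Union>e\<in>set_mset F. {t. e dvd pencil t})"
    proof
      fix t assume t: "t \<in> U - B"
      then obtain w where w: "irreducible w" "w dvd pencil t" using factor by blast
      then obtain d1 d2 d3 where "directed w d1 d2 d3" using B(2) nz t by blast
      from irreducible_dvd_imp_factor[OF dvdM[OF this] w(1) F] \<open>M \<noteq> 0\<close>
      obtain e where "e \<in># F" "e dvd w" by blast
      then show "t \<in> (\<Union>e\<in>set_mset F. {t. e dvd pencil t})" using w(2) dvd_trans by blast
    qed
    moreover have "finite {t. e dvd pencil t}" if "e \<in># F" for e
    proof -
      have "irreducible e" using F that by (simp add: mset_factors_def)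
      then show ?thesis by (intro finite_dvd_pencil irreducible_not_unit)
    qed
    ultimately show ?thesis by (rule finite_subset[OF _ finite_UN_I[OF finite_set_mset]])
  qed
  then have "finite ((U - B) \<union> B)" using B(1) by blast
  then have "finite (U \<union> B)" by (simp only: Un_Diff_cancel2)
  then obtain t where t: "t \<notin> U \<union> B" using ex_new_if_finite infinite_UNIV_char_0 by blast
  have "finite (insert t (U \<union> B))" using \<open>finite (U \<union> B)\<close> by simp
  then obtain u where u: "u \<notin> insert t (U \<union> B)" using ex_new_if_finite infinite_UNIV_char_0 by blast
  \<comment> \<open>Two constant members of the pencil have a vanishing combination, contradicting independence.\<close>
  obtain \<kappa> where \<kappa>: "pencil t = scalar3 \<kappa>" "\<kappa> \<noteq> 0" using t unit_imp_scalar3 unfolding U_def by blast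
  obtain \<kappa>' where \<kappa>': "pencil u = scalar3 \<kappa>'" "\<kappa>' \<noteq> 0" using u unit_imp_scalar3 unfolding U_def by blast
  have "scalar3 (\<kappa>' * t ^ 2 - \<kappa> * u ^ 2) * a + scalar3 (\<kappa>' * t - \<kappa> * u) * b + scalar3 (\<kappa>' - \<kappa>) * c
      = scalar3 \<kappa>' * pencil t - scalar3 \<kappa> * pencil u"
    by (simp add: scalar3.hom_minus scalar3.hom_mult algebra_simps)
  also have "\<dots> = 0" unfolding \<kappa> \<kappa>' by (simp add: mult.commute)
  finally have "\<kappa>' * t - \<kappa> * u = 0" "\<kappa>' - \<kappa> = 0" using indep by blast+
  then show False using \<kappa>(2) u by simp
qed

end

section \<open>Straightening the derivation\<close>

lemma k_automorphism_hom: "k_automorphism \<phi> \<Longrightarrow> comm_ring_hom \<phi>"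
proof
  assume \<phi>: "k_automorphism \<phi>"
  show "\<phi> 0 = 0" "\<phi> 1 = 1"
    using \<phi> unfolding k_automorphism_def by (metis scalar3.hom_zero scalar3.hom_one)+
qed (auto simp: k_automorphism_def)

lemma k_automorphism_comp:
  "k_automorphism \<phi> \<Longrightarrow> k_automorphism \<psi> \<Longrightarrow> k_automorphism (\<phi> \<circ> \<psi>)"
  by (auto simp: k_automorphism_def bij_comp)

lemma k_automorphism_inv:
  assumes "k_automorphism \<phi>"
  shows "k_automorphism (inv \<phi>)"
proof -
  have b: "bij \<phi>" using assms by (simp add: k_automorphism_def)
  then have i: "\<phi> (inv \<phi> f) = f" "inv \<phi> (\<phi> f) = f" for f
    by (simp_all add: bij_is_surj surj_f_inv_f bij_is_inj)
  have "inv \<phi> (f + g) = inv \<phi> f + inv \<phi> g" "inv \<phi> (f * g) = inv \<phi> f * inv \<phi> g"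
    "inv \<phi> (scalar3 t) = scalar3 t" for f g t
    using assms i unfolding k_automorphism_def by metis+
  then show ?thesis using bij_imp_bij_inv[OF b] by (simp add: k_automorphism_def)
qed

lemma k_automorphism_inv_simps:
  assumes "k_automorphism \<phi>"
  shows "\<phi> (inv \<phi> f) = f" "inv \<phi> (\<phi> f) = f" "\<phi> (scalar3 t) = scalar3 t"
  using assms by (simp_all add: k_automorphism_def bij_is_surj surj_f_inv_f bij_is_inj)

abbreviation "endo3 \<equiv> subst3 scalar3"

lemma endo3_hom: "comm_ring_hom (endo3 p q r)"
  by (intro subst3_hom scalar3_hom)

interpretation endo3: comm_ring_hom "endo3 p q r"
  by (rule endo3_hom)

lemma endo3_simps [simp]: "endo3 p q r (scalar3 c) = scalar3 c" "endo3 p q r var_x = p"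
  "endo3 p q r var_y = q" "endo3 p q r var_z = r"
  by (simp_all add: subst3_simps scalar3_hom)

lemma endo3_automorphism:
  assumes "endo3 p q r p' = var_x" "endo3 p q r q' = var_y" "endo3 p q r r' = var_z"
    "endo3 p' q' r' p = var_x" "endo3 p' q' r' q = var_y" "endo3 p' q' r' r = var_z"
  shows "k_automorphism (endo3 p q r)"
proof -
  have "(\<lambda>f. endo3 p q r (endo3 p' q' r' f)) = (\<lambda>f. f)" "(\<lambda>f. endo3 p' q' r' (endo3 p q r f)) = (\<lambda>f. f)"
    by (rule poly3_hom_eq[OF comm_ring_hom_comp[OF endo3_hom endo3_hom] id_hom]; simp add: assms)+
  then have "bij (endo3 p q r)" by (intro o_bij[of "endo3 p' q' r'"]) (simp_all add: fun_eq_iff)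
  then show ?thesis by (simp add: k_automorphism_def endo3.hom_add endo3.hom_mult)
qed

lemma fixes_x_polynomials:
  fixes h :: "'k::field poly3 \<Rightarrow> 'k poly3"
  assumes "comm_ring_hom h" "\<And>t. h (scalar3 t) = scalar3 t" "h var_x = var_x"
  shows "h [:[:p:]:] = [:[:p:]:]"
proof (induction p)
  case 0
  show ?case using assms(2)[of 0] by (simp add: scalar3_def)
next
  case (pCons t p)
  interpret comm_ring_hom h by fact
  have e: "[:[:pCons t p:]:] = scalar3 t + var_x * [:[:p:]:]" by (simp add: scalar3_def var_x_def)
  show ?case unfolding e hom_add hom_mult assms pCons.IH ..
qed

lemma fixes_xy_polynomials:
  fixes h :: "'k::field poly3 \<Rightarrow> 'k poly3"
  assumes "comm_ring_hom h" "\<And>t. h (scalar3 t) = scalar3 t" "h var_x = var_x" "h var_y = var_y"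
  shows "h [:g:] = [:g:]"
proof (induction g)
  case 0
  show ?case using assms(2)[of 0] by (simp add: scalar3_def)
next
  case (pCons p g)
  interpret comm_ring_hom h by fact
  have e: "[:pCons p g:] = [:[:p:]:] + var_y * [:g:]" by (simp add: var_y_def)
  show ?case unfolding e hom_add hom_mult assms pCons.IH fixes_x_polynomials[OF assms(1-3)] ..
qed

lemma partial_z_zero_imp_const:
  fixes f :: "'k::field_char_0 poly3"
  assumes "partial_z f = 0"
  shows "f = [:coeff f 0:]"
  using assms by (auto simp: partial_z_def pderiv_eq_0_iff elim: degree_eq_zeroE)

lemma partial_yz_zero_imp_x_polynomial:
  fixes f :: "'k::field_char_0 poly3"
  assumes "partial_y f = 0" "partial_z f = 0"
  shows "f = [:[:coeff (coeff f 0) 0:]:]"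
proof -
  have f: "f = [:coeff f 0:]" using partial_z_zero_imp_const[OF assms(2)] .
  have "partial_y [:coeff f 0:] = [:pderiv (coeff f 0):]" by (simp add: partial_y_def map_poly_const)
  then have "pderiv (coeff f 0) = 0" using assms(1) f by simp
  then have "coeff f 0 = [:coeff (coeff f 0) 0:]" by (auto simp: pderiv_eq_0_iff elim: degree_eq_zeroE)
  then show ?thesis using f by simp
qed

lemma derivation_intertwine:
  assumes h: "comm_ring_hom h" and D: "derivation_along id D" and hs: "\<And>t. h (scalar3 t) = scalar3 t"
    and v: "D (h var_x) = h (E var_x)" "D (h var_y) = h (E var_y)" "D (h var_z) = h (E var_z)"
    and E: "derivation_along id E"
  shows "D (h f) = h (E f)"
proof -
  interpret comm_ring_hom h by fact
  have 1: "derivation_along h (\<lambda>f. D (h f))"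
    using D by (simp add: derivation_along_def hom_add hom_mult hs)
  have 2: "derivation_along h (\<lambda>f. h (E f))"
    using E by (simp add: derivation_along_def hom_add hom_mult)
  show ?thesis by (rule derivation_along_eq[OF 1 2]) (simp_all add: v)
qed

context nice_slice
begin

text \<open>
  Solving \<open>D c = 0\<close> and \<open>D s = 1\<close> for \<open>c\<^sub>y\<close> shows \<open>c dvd c\<^sub>y\<close>, so \<open>c\<^sub>y = 0\<close>, and then \<open>c\<^sub>z = 0\<close>; likewise
  for \<open>b\<close>. Setting \<open>y = z = 0\<close> in \<open>D s = 1\<close> gives the Bezout relation in \<open>k[x]\<close>.
\<close>
lemma straighten_two_variables:
  assumes a0: "a = 0"
  shows "\<exists>\<psi>. k_automorphism \<psi> \<and> (\<forall>f. D (\<psi> f) = \<psi> (partial_z f))"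
proof -
  have grad: "D f = b * partial_y f + c * partial_z f" for f using D_gradient[of f] by (simp add: a0)
  have one: "b * partial_y s + c * partial_z s = 1" using grad[of s] slice by simp
  have bb: "b * partial_y b + c * partial_z b = 0" and cc: "b * partial_y c + c * partial_z c = 0"
    using grad[of b] grad[of c] by simp_all
  have "partial_y c = partial_y c * (b * partial_y s + c * partial_z s)
      - partial_y s * (b * partial_y c + c * partial_z c)"
    unfolding one cc by simp
  also have "\<dots> = c * (partial_y c * partial_z s - partial_y s * partial_z c)" by (simp add: algebra_simps)
  finally have "c dvd dirder 0 1 0 c" unfolding dirder_axes by (rule dvdI)
  from dvd_dirder_imp_zero[OF this] have c_y: "partial_y c = 0" unfolding dirder_axes .
  then have c_z: "partial_z c = 0" using cc by (auto simp: partial_z_def)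
  have "partial_z b = partial_z b * (b * partial_y s + c * partial_z s)
      - partial_z s * (b * partial_y b + c * partial_z b)"
    unfolding one bb by simp
  also have "\<dots> = b * (partial_z b * partial_y s - partial_z s * partial_y b)" by (simp add: algebra_simps)
  finally have "b dvd dirder 0 0 1 b" unfolding dirder_axes by (rule dvdI)
  from dvd_dirder_imp_zero[OF this] have b_z: "partial_z b = 0" unfolding dirder_axes .
  then have b_y: "partial_y b = 0" using bb by (auto simp: partial_y_def)
  obtain p q where b: "b = [:[:p:]:]" and c: "c = [:[:q:]:]"
    using partial_yz_zero_imp_x_polynomial[OF b_y b_z] partial_yz_zero_imp_x_polynomial[OF c_y c_z] by blast
  define \<beta> where "\<beta> = [:[:poly (poly (partial_y s) 0) 0:]:]"
  define \<gamma> where "\<gamma> = [:[:poly (poly (partial_z s) 0) 0:]:]"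
  have "poly (poly (b * partial_y s + c * partial_z s) 0) 0 = 1" by (simp add: one)
  then have "p * poly (poly (partial_y s) 0) 0 + q * poly (poly (partial_z s) 0) 0 = 1"
    by (simp add: b c)
  then have bez: "b * \<beta> + c * \<gamma> = 1" by (simp add: b c \<beta>_def \<gamma>_def)
  let ?\<psi> = "endo3 var_x (c * var_y - b * var_z) (\<beta> * var_y + \<gamma> * var_z)"
  let ?\<psi>' = "endo3 var_x (\<gamma> * var_y + b * var_z) (c * var_z - \<beta> * var_y)"
  have fx: "endo3 var_x u v b = b" "endo3 var_x u v c = c" "endo3 var_x u v \<beta> = \<beta>" "endo3 var_x u v \<gamma> = \<gamma>" for u v
    unfolding b c \<beta>_def \<gamma>_def by (simp_all add: fixes_x_polynomials[OF endo3_hom])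
  \<comment> \<open>Inserting the Bezout relation on the right makes the identities below purely formal.\<close>
  have bez': "f = (b * \<beta> + c * \<gamma>) * f" for f by (simp add: bez)
  have aut: "k_automorphism ?\<psi>"
  proof (rule endo3_automorphism)
    show "?\<psi> (\<gamma> * var_y + b * var_z) = var_y"
      by (subst (2) bez') (simp add: endo3.hom_add endo3.hom_mult fx algebra_simps)
    show "?\<psi> (c * var_z - \<beta> * var_y) = var_z"
      by (subst (2) bez') (simp add: endo3.hom_minus endo3.hom_mult fx algebra_simps)
    show "?\<psi>' (c * var_y - b * var_z) = var_y"
      by (subst (2) bez') (simp add: endo3.hom_minus endo3.hom_mult fx algebra_simps)
    show "?\<psi>' (\<beta> * var_y + \<gamma> * var_z) = var_z"
      by (subst (2) bez') (simp add: endo3.hom_add endo3.hom_mult fx algebra_simps)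
  qed simp_all
  have "D \<beta> = 0" "D \<gamma> = 0"
    unfolding grad[of \<beta>] grad[of \<gamma>]
    by (simp_all add: \<beta>_def \<gamma>_def partial_y_def partial_z_def map_poly_const)
  then have u: "D (c * var_y - b * var_z) = 0" and v: "D (\<beta> * var_y + \<gamma> * var_z) = 1"
    unfolding D_diff D_add D_mult D_b D_c bez[symmetric] by (simp_all only: mult_zero_left mult_zero_right add_0 mult.commute diff_self)
  have "D (?\<psi> f) = ?\<psi> (partial_z f)" for f
    by (rule derivation_intertwine[OF endo3_hom D_along endo3_simps(1) _ _ _ derivation_partial(3)])
      (simp_all only: endo3_simps partial_var endo3.hom_zero endo3.hom_one a0 u v)
  then show ?thesis using aut by blast
qed

text \<open>
  The conjugate of \<open>D\<close> by \<open>\<rho>\<close> kills \<open>x\<close>. It stays nice because \<open>D\<^sup>2\<close> vanishes on the new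
  variables, as it does for a linear change of coordinates.
\<close>
lemma straighten_conjugate:
  assumes \<rho>: "k_automorphism \<rho>" and lx: "D (\<rho> var_x) = 0"
    and ly: "D (D (\<rho> var_y)) = 0" and lz: "D (D (\<rho> var_z)) = 0"
  shows "\<exists>\<psi>. k_automorphism \<psi> \<and> (\<forall>f. D (\<psi> f) = \<psi> (partial_z f))"
proof -
  define E where "E = (\<lambda>f. inv \<rho> (D (\<rho> f)))"
  interpret \<rho>: comm_ring_hom \<rho> by (rule k_automorphism_hom[OF \<rho>])
  interpret i: comm_ring_hom "inv \<rho>" by (rule k_automorphism_hom[OF k_automorphism_inv[OF \<rho>]])
  note [simp] = k_automorphism_inv_simps[OF \<rho>] k_automorphism_inv_simps(3)[OF k_automorphism_inv[OF \<rho>]]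
  interpret E: nice_slice E "inv \<rho> s"
  proof
    show "k_derivation E"
      by (simp add: k_derivation_def E_def \<rho>.hom_add \<rho>.hom_mult D_add D_mult i.hom_add i.hom_mult)
    show "nice_derivation E"
      by (simp add: nice_derivation_def E_def lx ly lz)
    show "E (inv \<rho> s) = 1" by (simp add: E_def slice)
  qed
  have "E var_x = 0" by (simp add: E_def lx)
  then obtain \<psi> where \<psi>: "k_automorphism \<psi>" "\<And>f. E (\<psi> f) = \<psi> (partial_z f)"
    using E.straighten_two_variables by blast
  have "D ((\<rho> \<circ> \<psi>) f) = (\<rho> \<circ> \<psi>) (partial_z f)" for f
    by (simp flip: \<psi>(2)) (simp add: E_def)
  then show ?thesis using k_automorphism_comp[OF \<rho> \<psi>(1)] by blast
qed

lemma straighten: "\<exists>\<psi>. k_automorphism \<psi> \<and> (\<forall>f. D (\<psi> f) = \<psi> (partial_z f))"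
proof -
  obtain l1 l2 l3 where l: "l1 \<noteq> 0 \<or> l2 \<noteq> 0 \<or> l3 \<noteq> 0" "scalar3 l1 * a + scalar3 l2 * b + scalar3 l3 * c = 0"
    using components_linearly_dependent by blast
  have inv: "scalar3 l * (scalar3 (inverse l) * f) = f" "scalar3 (inverse l) * (scalar3 l * f) = f" if "l \<noteq> 0" for l :: 'k and f
  proof -
    have "scalar3 l * scalar3 (inverse l) = 1" using that by (simp flip: scalar3.hom_mult)
    then show "scalar3 l * (scalar3 (inverse l) * f) = f" "scalar3 (inverse l) * (scalar3 l * f) = f"
      by (simp_all flip: mult.assoc add: mult.commute[of "scalar3 (inverse l)"])
  qed
  note hom = endo3.hom_add endo3.hom_minus endo3.hom_mult
  \<comment> \<open>The combination becomes the image of \<open>x\<close>, which takes the place of a variable that occurs in it.\<close>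
  consider "l1 \<noteq> 0" | "l1 = 0" "l2 \<noteq> 0" | "l1 = 0" "l2 = 0" "l3 \<noteq> 0" using l(1) by blast
  then show ?thesis
  proof cases
    case 1
    let ?L = "scalar3 l1 * var_x + scalar3 l2 * var_y + scalar3 l3 * var_z"
    have "k_automorphism (endo3 ?L var_y var_z)"
      by (rule endo3_automorphism[of _ _ _ "scalar3 (inverse l1) * (var_x - scalar3 l2 * var_y - scalar3 l3 * var_z)" var_y var_z])
        (simp_all add: hom inv[OF 1])
    then show ?thesis by (rule straighten_conjugate) (simp_all add: D_add D_scalar_mult l)
  next
    case 2
    let ?L = "scalar3 l2 * var_y + scalar3 l3 * var_z"
    have "k_automorphism (endo3 ?L var_x var_z)"
      by (rule endo3_automorphism[of _ _ _ var_y "scalar3 (inverse l2) * (var_x - scalar3 l3 * var_z)" var_z])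
        (simp_all add: hom inv[OF 2(2)])
    moreover have "D ?L = 0" using l(2) 2(1) by (simp add: D_add D_scalar_mult)
    ultimately show ?thesis by (intro straighten_conjugate[of "endo3 ?L var_x var_z"]) (simp_all only: endo3_simps D_a D_c D_0)
  next
    case 3
    have "k_automorphism (endo3 (scalar3 l3 * var_z) var_y var_x)"
      by (rule endo3_automorphism[of _ _ _ var_z var_y "scalar3 (inverse l3) * var_x"])
        (simp_all add: hom inv[OF 3(3)])
    moreover have "D (scalar3 l3 * var_z) = 0" using l(2) 3(1,2) by (simp add: D_scalar_mult)
    ultimately show ?thesis
      by (intro straighten_conjugate[of "endo3 (scalar3 l3 * var_z) var_y var_x"]) (simp_all only: endo3_simps D_a D_b)
  qed
qed

text \<open>
  In straightened coordinates the slice is \<open>z + g(x, y)\<close>, and the translation by \<open>g\<close> commutes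
  with \<open>\<partial>/\<partial>z\<close>.
\<close>
lemma straighten_slice:
  "\<exists>\<psi>. k_automorphism \<psi> \<and> (\<forall>f. D (\<psi> f) = \<psi> (partial_z f)) \<and> \<psi> var_z = s"
proof -
  obtain \<psi> where \<psi>: "k_automorphism \<psi>" "\<And>f. D (\<psi> f) = \<psi> (partial_z f)" using straighten by blast
  interpret \<psi>: comm_ring_hom \<psi> by (rule k_automorphism_hom[OF \<psi>(1)])
  note [simp] = k_automorphism_inv_simps[OF \<psi>(1)]
  define \<sigma> where "\<sigma> = inv \<psi> s"
  have "\<psi> (partial_z \<sigma>) = \<psi> 1" by (simp add: \<sigma>_def slice flip: \<psi>(2))
  then have "partial_z \<sigma> = 1" using k_automorphism_inv_simps(2)[OF \<psi>(1)] by metis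
  then have "partial_z (\<sigma> - var_z) = 0" by (simp add: partial_z_def pderiv_diff var_z_def pderiv_pCons)
  then obtain g where g: "\<sigma> - var_z = [:g:]" using partial_z_zero_imp_const by blast
  let ?\<chi> = "endo3 var_x var_y (var_z + [:g:])"
  have fx: "endo3 var_x var_y r [:g:] = [:g:]" for r by (rule fixes_xy_polynomials[OF endo3_hom]) simp_all
  have \<chi>: "k_automorphism ?\<chi>"
    by (rule endo3_automorphism[of _ _ _ var_x var_y "var_z - [:g:]"])
      (simp_all only: endo3.hom_add endo3.hom_minus fx endo3_simps add_diff_cancel_right' diff_add_cancel)
  have \<chi>d: "partial_z (?\<chi> f) = ?\<chi> (partial_z f)" for f
  proof (rule derivation_intertwine[OF endo3_hom derivation_partial(3) _ _ _ _ derivation_partial(3)])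
    show "partial_z (?\<chi> var_z) = ?\<chi> (partial_z var_z)"
      by (simp only: endo3_simps partial_var partial_simps endo3.hom_one) (simp add: partial_z_def)
  qed simp_all
  have "(\<psi> \<circ> ?\<chi>) var_z = s" using g by (simp add: \<sigma>_def flip: g)
  moreover have "D ((\<psi> \<circ> ?\<chi>) f) = (\<psi> \<circ> ?\<chi>) (partial_z f)" for f by (simp add: \<psi>(2) \<chi>d)
  ultimately show ?thesis using k_automorphism_comp[OF \<psi>(1) \<chi>] by blast
qed

end

section \<open>The action attached to the slice\<close>

definition zscale :: "'k::field \<Rightarrow> 'k poly3 \<Rightarrow> 'k poly3" where
  "zscale u = endo3 var_x var_y (scalar3 u * var_z)"

lemma zscale_hom: "comm_ring_hom (zscale u)"
  unfolding zscale_def by (rule endo3_hom)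

lemma zscale_simps [simp]: "zscale u (scalar3 c) = scalar3 c" "zscale u var_x = var_x"
  "zscale u var_y = var_y" "zscale u var_z = scalar3 u * var_z"
  by (simp_all add: zscale_def)

interpretation zscale: comm_ring_hom "zscale u"
  by (rule zscale_hom)

lemma zscale_1: "zscale 1 = (\<lambda>f. f)"
  by (rule poly3_hom_eq[OF zscale_hom id_hom]) simp_all

lemma zscale_mult: "zscale (u * v) = (\<lambda>f. zscale u (zscale v f))"
  by (rule poly3_hom_eq[OF zscale_hom comm_ring_hom_comp[OF zscale_hom zscale_hom]])
    (simp_all add: scalar3.hom_mult zscale.hom_mult mult.assoc mult.left_commute)

lemma zscale_automorphism:
  assumes "u \<noteq> 0"
  shows "k_automorphism (zscale u)"
proof -
  have "(\<lambda>f. zscale u (zscale (inverse u) f)) = (\<lambda>f. f)" "(\<lambda>f. zscale (inverse u) (zscale u f)) = (\<lambda>f. f)"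
    using assms by (simp_all add: zscale_1 flip: zscale_mult)
  then have "bij (zscale u)" by (intro o_bij[of "zscale (inverse u)"]) (simp_all add: fun_eq_iff)
  then show ?thesis by (simp add: k_automorphism_def zscale.hom_add zscale.hom_mult)
qed

lemma monom_eq_var_z_power: "monom g i = [:g:] * var_z ^ i"
  unfolding var_z_def x_as_monom x_pow_n by (simp add: smult_monom)

lemma zscale_monom: "zscale u (monom g i) = scalar3 (u ^ i) * monom g i"
proof -
  have "zscale u [:g:] = [:g:]" by (rule fixes_xy_polynomials[OF zscale_hom]) simp_all
  then show ?thesis
    by (simp only: monom_eq_var_z_power zscale.hom_mult zscale.hom_power zscale_simps power_mult_distrib
      scalar3.hom_power mult.left_commute)
qed

lemma zscale_expansion:
  "zscale u f = (\<Sum>i\<le>degree f. scalar3 (u ^ i) * monom (coeff f i) i)"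
  by (subst (1) poly_as_sum_of_monoms[of f, symmetric]) (simp only: zscale.hom_sum zscale_monom)

text \<open>
  Compared with \<open>zscale_expansion\<close>, the factor \<open>u\<^sup>i\<close> is replaced by its logarithmic derivative at
  \<open>u = 1\<close>; this makes \<open>z \<partial>/\<partial>z\<close> the generator of the scaling action.
\<close>
lemma euler_expansion:
  fixes f :: "'k::field poly3"
  shows "var_z * partial_z f = (\<Sum>i\<le>degree f. of_nat i * monom (coeff f i) i)"
proof -
  have m: "var_z * partial_z (monom g i) = of_nat i * monom g i" for g :: "'k poly poly" and i
  proof (cases i)
    case (Suc j)
    have "var_z * monom h j = monom h (Suc j)" for h :: "'k poly poly"
      by (simp add: var_z_def monom_Suc)
    then show ?thesis
      by (simp add: partial_z_def pderiv_monom Suc smult_monom of_nat_poly del: of_nat_Suc)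
  qed (simp add: partial_z_def monom_0 pderiv_pCons)
  have "partial_z (sum F A) = (\<Sum>i\<in>A. partial_z (F i))" for F :: "nat \<Rightarrow> 'k poly3" and A
    by (simp add: partial_z_def pderiv_sum)
  then show ?thesis
    by (subst (1) poly_as_sum_of_monoms[of f, symmetric]) (simp only: sum_distrib_left m)
qed

text \<open>
  An automorphism \<open>\<psi>\<close> that carries \<open>\<partial>/\<partial>z\<close> to \<open>D\<close> and \<open>z\<close> to \<open>s\<close>. It maps \<open>k[x,y]\<close> onto the kernel of
  \<open>D\<close>, so that expansion in powers of \<open>z\<close> becomes expansion in powers of \<open>s\<close>.
\<close>
locale straightened =
  fixes D :: "'k::field_char_0 poly3 \<Rightarrow> 'k poly3" and s :: "'k poly3" and \<psi> :: "'k poly3 \<Rightarrow> 'k poly3"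
  assumes aut: "k_automorphism \<psi>" and D_psi: "D (\<psi> f) = \<psi> (partial_z f)" and psi_z: "\<psi> var_z = s"
begin

lemmas psi_inv [simp] = k_automorphism_inv_simps[OF aut]

lemma hom: "comm_ring_hom \<psi>" and inv_hom: "comm_ring_hom (inv \<psi>)"
  by (intro k_automorphism_hom k_automorphism_inv aut)+

sublocale comm_ring_hom \<psi> by (rule hom)

lemma psi_const_hom: "comm_ring_hom (\<lambda>g. \<psi> [:g:])"
  by (rule comm_ring_hom_comp[OF hom const_hom])

lemma eval_coordinate: "poly (map_poly (\<lambda>g. \<psi> [:g:]) f) (scalar3 u * s) = \<psi> (zscale u f)"
proof -
  interpret c: comm_ring_hom "\<lambda>g. \<psi> [:g:]" by (rule psi_const_hom)
  have v: "eval_poly (\<lambda>g. \<psi> [:g:]) [:g:] r = \<psi> [:g:]" "eval_poly (\<lambda>g. \<psi> [:g:]) [:0, 1:] r = r" for g r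
    using eval_poly_const[OF psi_const_hom] eval_poly_var[OF psi_const_hom] by blast+
  have "(\<lambda>f. eval_poly (\<lambda>g. \<psi> [:g:]) f (scalar3 u * s)) = (\<lambda>f. \<psi> (zscale u f))"
  proof (rule poly3_hom_eq[OF eval_poly_hom[OF psi_const_hom] comm_ring_hom_comp[OF hom zscale_hom]])
    show "eval_poly (\<lambda>g. \<psi> [:g:]) (scalar3 c) (scalar3 u * s) = \<psi> (zscale u (scalar3 c))" for c
      unfolding zscale_simps by (simp only: scalar3_def v)
    show "eval_poly (\<lambda>g. \<psi> [:g:]) var_x (scalar3 u * s) = \<psi> (zscale u var_x)"
      unfolding zscale_simps by (simp only: var_x_def v)
    show "eval_poly (\<lambda>g. \<psi> [:g:]) var_y (scalar3 u * s) = \<psi> (zscale u var_y)"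
      unfolding zscale_simps by (simp only: var_y_def v)
    show "eval_poly (\<lambda>g. \<psi> [:g:]) var_z (scalar3 u * s) = \<psi> (zscale u var_z)"
      unfolding zscale_simps hom_mult psi_inv psi_z by (simp only: var_z_def v)
  qed
  then show ?thesis unfolding eval_poly_def by (rule fun_cong)
qed

text \<open>
  Pulled back by \<open>\<psi>\<close>, the coefficients of \<open>Q\<close> lie in \<open>k[x,y]\<close> and \<open>s\<close> becomes \<open>z\<close>, so the expansion
  is that of \<open>f\<close> as a polynomial in \<open>z\<close>. This identifies the definite description in
  \<open>slice_action\<close>.
\<close>
lemma kernel_poly_unique:
  assumes ker: "\<And>i. D (coeff Q i) = 0" and val: "poly Q s = \<psi> f"
  shows "Q = map_poly (\<lambda>g. \<psi> [:g:]) f"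
proof -
  interpret c: comm_ring_hom "\<lambda>g. \<psi> [:g:]" by (rule psi_const_hom)
  have zero: "coeff (inv \<psi> 0) 0 = 0" by (metis psi_inv(2) hom_zero coeff_0)
  define F where "F = map_poly (\<lambda>q. coeff (inv \<psi> q) 0) Q"
  have "\<psi> [:coeff F i:] = coeff Q i" for i
  proof -
    have "\<psi> (partial_z (inv \<psi> (coeff Q i))) = \<psi> 0" using ker[of i] D_psi[of "inv \<psi> (coeff Q i)"] by simp
    then have "partial_z (inv \<psi> (coeff Q i)) = 0" by (metis psi_inv(2))
    then have "inv \<psi> (coeff Q i) = [:coeff F i:]"
      using partial_z_zero_imp_const zero by (simp add: F_def coeff_map_poly)
    then show ?thesis by (metis psi_inv(1))
  qed
  then have Q: "Q = map_poly (\<lambda>g. \<psi> [:g:]) F" by (intro poly_eqI) simp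
  then have "\<psi> f = \<psi> F" using val eval_coordinate[of F 1] by (simp add: zscale_1)
  then have "f = F" by (metis psi_inv(2))
  then show ?thesis using Q by simp
qed

lemma slice_action_eq: "slice_action D s N t b = \<psi> (zscale (t powi N) (inv \<psi> b))"
proof -
  interpret c: comm_ring_hom "\<lambda>g. \<psi> [:g:]" by (rule psi_const_hom)
  let ?P = "map_poly (\<lambda>g. \<psi> [:g:]) (inv \<psi> b)"
  have "(THE P. (\<forall>i. D (coeff P i) = 0) \<and> poly P s = b) = ?P"
  proof (rule the_equality)
    have "D (coeff ?P i) = 0" for i by (simp add: D_psi partial_z_def pderiv_pCons)
    moreover have "poly ?P s = b" using eval_coordinate[of "inv \<psi> b" 1] by (simp add: zscale_1)
    ultimately show "(\<forall>i. D (coeff ?P i) = 0) \<and> poly ?P s = b" by blast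
    show "Q = ?P" if "(\<forall>i. D (coeff Q i) = 0) \<and> poly Q s = b" for Q
      using kernel_poly_unique[of Q "inv \<psi> b"] that by simp
  qed
  then show ?thesis by (simp add: slice_action_def eval_coordinate)
qed

text \<open>
  The \<open>z\<close>-degree \<open>i\<close> part has weight \<open>N i\<close>; as \<open>N \<noteq> 0\<close>, different degrees have different weights.
\<close>
lemma laurent_expansion:
  assumes N: "N \<noteq> 0"
  shows "\<exists>I c. finite I \<and> (\<forall>t. t \<noteq> 0 \<longrightarrow> slice_action D s N t b = (\<Sum>i\<in>I. scalar3 (t powi i) * c i)) \<and>
    of_int N * s * D b = (\<Sum>i\<in>I. of_int i * c i)"
proof -
  define f where "f = inv \<psi> b"
  define J where "J = {..degree f}"
  define e where "e = (\<lambda>i :: nat. N * int i)"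
  define c where "c = (\<lambda>j. \<psi> (monom (coeff f (nat (j div N))) (nat (j div N))))"
  have e: "inj_on e J" using N by (auto simp: e_def inj_on_def)
  have ce: "c (e i) = \<psi> (monom (coeff f i) i)" for i using N by (simp add: c_def e_def)
  have "slice_action D s N t b = (\<Sum>i\<in>e ` J. scalar3 (t powi i) * c i)" for t
  proof -
    have "slice_action D s N t b = (\<Sum>i\<in>J. scalar3 ((t powi N) ^ i) * \<psi> (monom (coeff f i) i))"
      by (simp add: slice_action_eq zscale_expansion hom_sum hom_mult J_def flip: f_def)
    also have "\<dots> = (\<Sum>i\<in>J. scalar3 (t powi e i) * c (e i))"
      by (simp add: ce) (simp add: e_def power_int_mult)
    finally show ?thesis by (simp add: sum.reindex[OF e])
  qed
  moreover have "of_int N * s * D b = (\<Sum>i\<in>e ` J. of_int i * c i)"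
  proof -
    have "of_int N * s * D b = of_int N * \<psi> (var_z * partial_z f)"
      using D_psi[of f] by (simp add: f_def hom_mult psi_z mult.assoc)
    also have "\<dots> = (\<Sum>i\<in>J. of_int (e i) * c (e i))"
      unfolding ce
      by (simp add: euler_expansion hom_sum hom_mult hom_of_nat e_def sum_distrib_left mult.assoc J_def)
    finally show ?thesis by (simp add: sum.reindex[OF e])
  qed
  moreover have "finite (e ` J)" by (simp add: J_def)
  ultimately show ?thesis by blast
qed

lemma action_associated:
  assumes N: "N \<noteq> 0"
  shows "gm_action_associated (\<lambda>b. of_int N * s * D b) (slice_action D s N)"
proof -
  have eq: "slice_action D s N t = \<psi> \<circ> (zscale (t powi N) \<circ> inv \<psi>)" for t
    by (simp add: fun_eq_iff slice_action_eq)
  have "k_automorphism (slice_action D s N t)" if "t \<noteq> 0" for t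
    unfolding eq using that by (intro k_automorphism_comp aut k_automorphism_inv zscale_automorphism) simp
  moreover have "slice_action D s N 1 = id" by (simp add: eq fun_eq_iff zscale_1)
  moreover have "slice_action D s N (t * u) = slice_action D s N t \<circ> slice_action D s N u" for t u
    by (simp add: eq fun_eq_iff power_int_mult_distrib zscale_mult)
  ultimately show ?thesis
    unfolding gm_action_associated_def gm_action_def
    using laurent_expansion[OF N] by (intro conjI allI impI) (assumption | meson)+
qed

lemma conjugate_to_partial_z: "inv \<psi> \<circ> D \<circ> inv (inv \<psi>) = partial_z"
proof -
  have "inv (inv \<psi>) = \<psi>" using aut by (simp add: k_automorphism_def inv_inv_eq)
  then show ?thesis by (simp add: fun_eq_iff D_psi)
qed

lemma conjugate_to_diagonal:
  "inv \<psi> \<circ> (\<lambda>b. of_int N * s * D b) \<circ> inv (inv \<psi>) = diagonal_derivation 0 0 (of_int N)"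
proof -
  have "inv (inv \<psi>) = \<psi>" using aut by (simp add: k_automorphism_def inv_inv_eq)
  moreover have "of_int N * s * D (\<psi> f) = \<psi> (of_int N * var_z * partial_z f)" for f
    by (simp add: D_psi hom_mult hom_of_int psi_z)
  moreover have "scalar3 (of_int N :: 'k) = of_int N" by (rule scalar3.hom_of_int)
  ultimately show ?thesis by (simp add: fun_eq_iff diagonal_derivation_def)
qed

end

theorem corollary6p7:
  fixes D :: "'k::{alg_closed_field, field_char_0} poly3 \<Rightarrow> 'k poly3"
    and s :: "'k poly3" and N :: int
  assumes "k_derivation D" and "locally_nilpotent D" and "nice_derivation D"
    and "slice D s" and "N \<noteq> 0"
  shows "(\<exists>\<phi>. k_automorphism \<phi> \<and> \<phi> \<circ> D \<circ> inv \<phi> = partial_z) \<and>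
    gm_action_associated (\<lambda>b. of_int N * s * D b) (slice_action D s N) \<and>
    gm_linearizable (slice_action D s N)"
proof -
  interpret nice_slice D s using assms by unfold_locales (simp_all add: slice_def)
  obtain \<psi> where "k_automorphism \<psi>" "\<And>f. D (\<psi> f) = \<psi> (partial_z f)" "\<psi> var_z = s"
    using straighten_slice by blast
  then interpret straightened D s \<psi> by unfold_locales
  show ?thesis
    unfolding gm_linearizable_def
    using k_automorphism_inv[OF aut] conjugate_to_partial_z action_associated[OF assms(5)]
      conjugate_to_diagonal by blast
qed

end
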